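(* Assume Martin's Axiom. Let $\mathcal{A}\subset\mathcal{B}$ be a set of projections with $|\mathcal{A}|<2^{\aleph_0}$, and suppose there is no finite subset $F\subseteq\mathcal{A}$ such that $\bigvee_{p\in F}\pi(p)=1$ in $\mathcal{P}$. Then there exists a noncompact projection $p\in\mathcal{B}$ that is almost orthogonal to every element of $\mathcal{A}$, i.e. $pq$ is compact for every $q\in\mathcal{A}$.
   Context: $\mathcal{B}$ is the algebra of bounded operators on $\ell^2(\omega)$, $\mathcal{K}$ the compact operators, $\pi:\mathcal{B}\to\mathcal{B}/\mathcal{K}$ the quotient map onto the Calkin algebra, and $\mathcal{P}$ the lattice of projections in the Calkin algebra, ordered by $\pi(p)\leq\pi(q)$ iff $p(1-q)$ is compact; $\bigvee$ denotes the lattice join in $\mathcal{P}$. *)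

theory Defs
  imports "HOL-Analysis.Analysis"
begin

unbundle cardinal_syntax

section \<open>The complex Hilbert space of square-summable sequences\<close>

typedef ell2 = "{x :: nat \<Rightarrow> complex. summable (\<lambda>n. (cmod (x n))\<^sup>2)}"
  morphisms coord Abs_ell2
proof
  show "(\<lambda>_. 0) \<in> {x :: nat \<Rightarrow> complex. summable (\<lambda>n. (cmod (x n))\<^sup>2)}"
    by simp
qed

setup_lifting type_definition_ell2

lemma summable_coord: "summable (\<lambda>n. (cmod (coord x n))\<^sup>2)"
  using coord[of x] by simp

lemma cmod_add_sq_le: "(cmod (a + b))\<^sup>2 \<le> 2 * (cmod a)\<^sup>2 + 2 * (cmod b)\<^sup>2"
proof -
  have "(cmod (a + b))\<^sup>2 \<le> (cmod a + cmod b)\<^sup>2"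
    by (intro power_mono norm_triangle_ineq) auto
  also have "\<dots> \<le> 2 * (cmod a)\<^sup>2 + 2 * (cmod b)\<^sup>2"
    using zero_le_power2[of "cmod a - cmod b"] unfolding power2_sum power2_diff by linarith
  finally show ?thesis .
qed

lemma summable_sq_add:
  fixes x y :: "nat \<Rightarrow> complex"
  assumes "summable (\<lambda>n. (cmod (x n))\<^sup>2)" "summable (\<lambda>n. (cmod (y n))\<^sup>2)"
  shows "summable (\<lambda>n. (cmod (x n + y n))\<^sup>2)"
proof (rule summable_comparison_test')
  show "summable (\<lambda>n. 2 * (cmod (x n))\<^sup>2 + 2 * (cmod (y n))\<^sup>2)"
    by (intro summable_add summable_mult assms)
  show "\<And>n. n \<ge> 0 \<Longrightarrow> norm ((cmod (x n + y n))\<^sup>2) \<le> 2 * (cmod (x n))\<^sup>2 + 2 * (cmod (y n))\<^sup>2"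
    using cmod_add_sq_le by simp
qed

lemma summable_sq_scale:
  fixes x :: "nat \<Rightarrow> complex"
  assumes "summable (\<lambda>n. (cmod (x n))\<^sup>2)"
  shows "summable (\<lambda>n. (cmod (c * x n))\<^sup>2)"
  unfolding norm_mult power_mult_distrib by (intro summable_mult assms)

lemma summable_cinner: "summable (\<lambda>n. coord x n * cnj (coord y n))"
proof (rule summable_comparison_test')
  show "summable (\<lambda>n. (cmod (coord x n))\<^sup>2 + (cmod (coord y n))\<^sup>2)"
    by (intro summable_add summable_coord)
  show "norm (coord x n * cnj (coord y n)) \<le> (cmod (coord x n))\<^sup>2 + (cmod (coord y n))\<^sup>2"
    if "n \<ge> 0" for n
  proof -
    have "2 * (cmod (coord x n) * cmod (coord y n)) \<le> (cmod (coord x n))\<^sup>2 + (cmod (coord y n))\<^sup>2"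
      using sum_squares_bound[of "cmod (coord x n)" "cmod (coord y n)"] by (simp add: mult.assoc)
    moreover have "0 \<le> cmod (coord x n) * cmod (coord y n)"
      by simp
    ultimately show ?thesis
      unfolding norm_mult complex_mod_cnj by linarith
  qed
qed

instantiation ell2 :: real_vector
begin

lift_definition zero_ell2 :: ell2 is "\<lambda>_. 0"
  by simp

lift_definition plus_ell2 :: "ell2 \<Rightarrow> ell2 \<Rightarrow> ell2" is "\<lambda>x y n. x n + y n"
  by (rule summable_sq_add)

lift_definition uminus_ell2 :: "ell2 \<Rightarrow> ell2" is "\<lambda>x n. - x n"
  by simp

lift_definition minus_ell2 :: "ell2 \<Rightarrow> ell2 \<Rightarrow> ell2" is "\<lambda>x y n. x n - y n"
proof -
  fix x y :: "nat \<Rightarrow> complex"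
  assume "summable (\<lambda>n. (cmod (x n))\<^sup>2)" "summable (\<lambda>n. (cmod (y n))\<^sup>2)"
  then show "summable (\<lambda>n. (cmod (x n - y n))\<^sup>2)"
    using summable_sq_add[of x "\<lambda>n. - y n"] by simp
qed

lift_definition scaleR_ell2 :: "real \<Rightarrow> ell2 \<Rightarrow> ell2" is "\<lambda>r x n. complex_of_real r * x n"
  by (rule summable_sq_scale)

instance
  by standard (transfer; simp add: fun_eq_iff algebra_simps)+

end

lift_definition scaleC :: "complex \<Rightarrow> ell2 \<Rightarrow> ell2" is "\<lambda>c x n. c * x n"
  by (rule summable_sq_scale)

lemma scaleC_add_right: "scaleC c (x + y) = scaleC c x + scaleC c y"
  by transfer (simp add: algebra_simps)

lemma scaleC_minus_right: "scaleC c (- x) = - scaleC c x"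
  by transfer simp

lemma scaleC_diff_right: "scaleC c (x - y) = scaleC c x - scaleC c y"
  by transfer (simp add: algebra_simps)

lemma scaleC_zero_right: "scaleC c 0 = 0"
  by transfer simp

lifting_update ell2.lifting
lifting_forget ell2.lifting

definition cinner :: "ell2 \<Rightarrow> ell2 \<Rightarrow> complex" where
  "cinner x y = (\<Sum>n. coord x n * cnj (coord y n))"

text \<open>The real inner product is the real part of the complex one; it induces the usual norm.\<close>

instantiation ell2 :: real_inner
begin

definition inner_ell2 :: "ell2 \<Rightarrow> ell2 \<Rightarrow> real" where
  "inner_ell2 x y = Re (cinner x y)"

definition norm_ell2 :: "ell2 \<Rightarrow> real" where
  "norm_ell2 x = sqrt (\<Sum>n. (cmod (coord x n))\<^sup>2)"

definition dist_ell2 :: "ell2 \<Rightarrow> ell2 \<Rightarrow> real" where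
  "dist_ell2 x y = norm (x - y)"

definition sgn_ell2 :: "ell2 \<Rightarrow> ell2" where
  "sgn_ell2 x = x /\<^sub>R norm x"

definition uniformity_ell2 :: "(ell2 \<times> ell2) filter" where
  "uniformity_ell2 = (INF e\<in>{0<..}. principal {(x, y). dist x y < e})"

definition open_ell2 :: "ell2 set \<Rightarrow> bool" where
  "open_ell2 U \<longleftrightarrow> (\<forall>x\<in>U. eventually (\<lambda>(x', y). x' = x \<longrightarrow> y \<in> U) uniformity)"

instance
proof
  fix x y z :: ell2 and r :: real and U :: "ell2 set"
  have Re_cinner: "inner x y = (\<Sum>n. Re (coord x n * cnj (coord y n)))" for x y :: ell2
    unfolding inner_ell2_def cinner_def by (rule Re_suminf[OF summable_cinner])
  have summable_Re: "summable (\<lambda>n. Re (coord x n * cnj (coord y n)))" for x y :: ell2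
    by (rule summable_Re[OF summable_cinner])
  have inner_self: "inner x x = (\<Sum>n. (cmod (coord x n))\<^sup>2)" for x :: ell2
    unfolding Re_cinner complex_norm_square[symmetric] by simp
  show "dist x y = norm (x - y)"
    by (rule dist_ell2_def)
  show "sgn x = x /\<^sub>R norm x"
    by (rule sgn_ell2_def)
  show "uniformity = (INF e\<in>{0<..}. principal {(x :: ell2, y). dist x y < e})"
    by (rule uniformity_ell2_def)
  show "open U \<longleftrightarrow> (\<forall>x\<in>U. eventually (\<lambda>(x', y). x' = x \<longrightarrow> y \<in> U) uniformity)"
    by (rule open_ell2_def)
  show "inner x y = inner y x"
    unfolding Re_cinner by (simp add: mult.commute)
  show "inner (x + y) z = inner x z + inner y z"
    unfolding Re_cinner suminf_add[OF summable_Re summable_Re]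
    by (simp add: plus_ell2.rep_eq algebra_simps)
  show "inner (r *\<^sub>R x) y = r * inner x y"
    unfolding Re_cinner suminf_mult[OF summable_Re, symmetric]
    by (simp add: scaleR_ell2.rep_eq algebra_simps)
  show "0 \<le> inner x x"
    unfolding inner_self by (intro suminf_nonneg summable_coord) simp
  show "inner x x = 0 \<longleftrightarrow> x = 0"
    unfolding inner_self using suminf_eq_zero_iff[OF summable_coord[of x]]
    by (simp add: coord_inject[symmetric] zero_ell2.rep_eq fun_eq_iff)
  show "norm x = sqrt (inner x x)"
    unfolding inner_self norm_ell2_def by simp
qed

end


section \<open>Bounded operators, compact operators and projections\<close>

text \<open>The library's bounded linear functions are only real linear; complex linearity is required
  separately.\<close>

typedef bop = "{T :: ell2 \<Rightarrow>\<^sub>L ell2. \<forall>c x. blinfun_apply T (scaleC c x) = scaleC c (blinfun_apply T x)}"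
  morphisms blinfun_of_bop Abs_bop
proof
  show "id_blinfun \<in> {T :: ell2 \<Rightarrow>\<^sub>L ell2. \<forall>c x. blinfun_apply T (scaleC c x) = scaleC c (blinfun_apply T x)}"
    by simp
qed

setup_lifting type_definition_bop

lift_definition app :: "bop \<Rightarrow> ell2 \<Rightarrow> ell2" is "\<lambda>T. blinfun_apply T" .

lemma bop_eqI: "(\<And>x. app S x = app T x) \<Longrightarrow> S = T"
  by transfer (rule blinfun_eqI)

instantiation bop :: "{ring, monoid_mult}"
begin

lift_definition zero_bop :: bop is 0
  by (simp add: scaleC_zero_right)

lift_definition one_bop :: bop is id_blinfun
  by simp

lift_definition plus_bop :: "bop \<Rightarrow> bop \<Rightarrow> bop" is "(+)"
  by (simp add: blinfun.add_left scaleC_add_right)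

lift_definition uminus_bop :: "bop \<Rightarrow> bop" is uminus
  by (simp add: blinfun.minus_left scaleC_minus_right)

lift_definition minus_bop :: "bop \<Rightarrow> bop \<Rightarrow> bop" is "(-)"
  by (simp add: blinfun.diff_left scaleC_diff_right)

lift_definition times_bop :: "bop \<Rightarrow> bop \<Rightarrow> bop" is "(o\<^sub>L)"
  by simp

instance
  by standard
    (transfer; rule blinfun_eqI; simp add: blinfun.add_left blinfun.add_right blinfun.diff_left
      blinfun.minus_left)+

end

lemma app_simps [simp]:
  "app 0 x = 0" "app 1 x = x" "app (S + T) x = app S x + app T x" "app (- S) x = - app S x"
  "app (S - T) x = app S x - app T x" "app (S * T) x = app S (app T x)"
  by (transfer; simp add: blinfun.add_left blinfun.diff_left blinfun.minus_left)+

lemma bounded_linear_app: "bounded_linear (app T)"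
  by transfer (rule blinfun.bounded_linear_right)

definition adjoint_pair :: "bop \<Rightarrow> bop \<Rightarrow> bool" where
  "adjoint_pair S T \<longleftrightarrow> (\<forall>x y. cinner (app S x) y = cinner x (app T y))"

definition projection :: "bop \<Rightarrow> bool" where
  "projection p \<longleftrightarrow> p * p = p \<and> adjoint_pair p p"

definition compact_op :: "bop \<Rightarrow> bool" where
  "compact_op T \<longleftrightarrow> compact (closure (app T ` cball 0 1))"

lemma compact_opI:
  assumes "compact C" "app T ` cball 0 1 \<subseteq> C"
  shows "compact_op T"
proof -
  have "closure (app T ` cball 0 1) \<subseteq> C"
    using assms by (intro closure_minimal compact_imp_closed)
  then have "C \<inter> closure (app T ` cball 0 1) = closure (app T ` cball 0 1)"
    by blast
  then show ?thesis
    unfolding compact_op_def using compact_Int_closed[OF assms(1) closed_closure] by metis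
qed

lemma compact_op_add:
  assumes "compact_op S" "compact_op T"
  shows "compact_op (S + T)"
proof (rule compact_opI)
  let ?S = "closure (app S ` cball 0 1)" and ?T = "closure (app T ` cball 0 1)"
  show "compact {x + y | x y. x \<in> ?S \<and> y \<in> ?T}"
    using assms unfolding compact_op_def by (rule compact_sums)
  show "app (S + T) ` cball 0 1 \<subseteq> {x + y | x y. x \<in> ?S \<and> y \<in> ?T}"
  proof
    fix y assume "y \<in> app (S + T) ` cball 0 1"
    then obtain x where "x \<in> cball 0 1" "y = app S x + app T x"
      by auto
    moreover from this(1) have "app S x \<in> ?S" "app T x \<in> ?T"
      by (intro subsetD[OF closure_subset] imageI; assumption)+
    ultimately show "y \<in> {x + y | x y. x \<in> ?S \<and> y \<in> ?T}"
      by blast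
  qed
qed

lemma compact_op_mult_left:
  assumes "compact_op T"
  shows "compact_op (S * T)"
proof (rule compact_opI)
  show "compact (app S ` closure (app T ` cball 0 1))"
    using assms unfolding compact_op_def
    by (intro compact_continuous_image linear_continuous_on bounded_linear_app)
  show "app (S * T) ` cball 0 1 \<subseteq> app S ` closure (app T ` cball 0 1)"
  proof
    fix y assume "y \<in> app (S * T) ` cball 0 1"
    then obtain x where "x \<in> cball 0 1" "y = app S (app T x)"
      by auto
    moreover from this(1) have "app T x \<in> closure (app T ` cball 0 1)"
      by (intro subsetD[OF closure_subset] imageI)
    ultimately show "y \<in> app S ` closure (app T ` cball 0 1)"
      by blast
  qed
qed

lemma compact_op_mult_right:
  assumes "compact_op S"
  shows "compact_op (S * T)"
proof -
  interpret T: bounded_linear "app T" by (rule bounded_linear_app)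
  interpret S: bounded_linear "app S" by (rule bounded_linear_app)
  obtain K where K: "K > 0" "\<And>x. norm (app T x) \<le> norm x * K"
    using T.pos_bounded by blast
  show ?thesis
  proof (rule compact_opI)
    show "compact ((*\<^sub>R) K ` closure (app S ` cball 0 1))"
      using assms unfolding compact_op_def by (rule compact_scaling)
    show "app (S * T) ` cball 0 1 \<subseteq> (*\<^sub>R) K ` closure (app S ` cball 0 1)"
    proof
      fix y assume "y \<in> app (S * T) ` cball 0 1"
      then obtain x where x: "norm x \<le> 1" "y = app S (app T x)"
        by auto
      have "norm (app T x) \<le> K"
        using K(2)[of x] mult_right_mono[OF x(1), of K] K(1) by linarith
      then have "app T x /\<^sub>R K \<in> cball 0 1"
        using K(1) by (simp add: divide_simps)
      then have "app S (app T x /\<^sub>R K) \<in> closure (app S ` cball 0 1)"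
        by (intro subsetD[OF closure_subset] imageI)
      moreover have "y = K *\<^sub>R app S (app T x /\<^sub>R K)"
        using K(1) x(2) by (simp add: S.scaleR)
      ultimately show "y \<in> (*\<^sub>R) K ` closure (app S ` cball 0 1)"
        by (rule rev_image_eqI)
    qed
  qed
qed

lemma compact_op_zero: "compact_op 0"
  by (rule compact_opI[of "{0}"]) auto

lemma compact_op_uminus: "compact_op T \<Longrightarrow> compact_op (- T)"
  using compact_op_mult_left[of T "- 1"] by simp


section \<open>The Calkin algebra and its projections\<close>

quotient_type calkin = bop / "\<lambda>S T. compact_op (S - T)"
  morphisms rep_calkin \<pi>
proof (rule equivpI)
  show "reflp (\<lambda>S T. compact_op (S - T))"
    by (simp add: reflp_def compact_op_zero)
  show "symp (\<lambda>S T. compact_op (S - T))"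
    by (simp add: symp_def) (metis compact_op_uminus minus_diff_eq)
  show "transp (\<lambda>S T. compact_op (S - T))"
    by (simp add: transp_def) (metis compact_op_add diff_add_cancel add_diff_eq)
qed

lemma compact_op_mult_cong:
  assumes "compact_op (S - S')" "compact_op (T - T')"
  shows "compact_op (S * T - S' * T')"
proof -
  have "S * T - S' * T' = (S - S') * T + S' * (T - T')"
    by (simp add: algebra_simps)
  then show ?thesis
    using assms by (simp add: compact_op_add compact_op_mult_left compact_op_mult_right)
qed

instantiation calkin :: "{ring, monoid_mult}"
begin

lift_definition zero_calkin :: calkin is 0 .

lift_definition one_calkin :: calkin is 1 .

lift_definition plus_calkin :: "calkin \<Rightarrow> calkin \<Rightarrow> calkin" is "(+)"
proof -
  fix S S' T T' :: bop
  assume "compact_op (S - S')" "compact_op (T - T')"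
  then show "compact_op (S + T - (S' + T'))"
    by (metis compact_op_add add_diff_add)
qed

lift_definition uminus_calkin :: "calkin \<Rightarrow> calkin" is uminus
proof -
  fix S S' :: bop
  assume "compact_op (S - S')"
  then show "compact_op (- S - - S')"
    using compact_op_uminus[of "S - S'"] by simp
qed

lift_definition minus_calkin :: "calkin \<Rightarrow> calkin \<Rightarrow> calkin" is "(-)"
proof -
  fix S S' T T' :: bop
  assume "compact_op (S - S')" "compact_op (T - T')"
  then have "compact_op ((S - S') + - (T - T'))"
    by (intro compact_op_add compact_op_uminus)
  then show "compact_op (S - T - (S' - T'))"
    by (simp add: algebra_simps)
qed

lift_definition times_calkin :: "calkin \<Rightarrow> calkin \<Rightarrow> calkin" is "(*)"
  by (rule compact_op_mult_cong)

instance
  by standard (transfer; simp add: algebra_simps compact_op_zero)+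

end

text \<open>An element $x$ of the quotient is a projection iff $x = x^* = x^2$, where $\pi(T)^* = \pi(T^*)$;
  \<open>adjoint_pair T S\<close> says that $S = T^*$.\<close>

definition calkin_projections :: "calkin set" where
  "calkin_projections = {x. x * x = x \<and> (\<exists>T S. adjoint_pair T S \<and> \<pi> T = x \<and> \<pi> S = x)}"

text \<open>The order is only meant for elements of \<^const>\<open>calkin_projections\<close>.\<close>

lift_definition calkin_le :: "calkin \<Rightarrow> calkin \<Rightarrow> bool" is "\<lambda>p q. compact_op (p * (1 - q))"
proof -
  have *: "compact_op (p' * (1 - q'))"
    if "compact_op (p - p')" "compact_op (q - q')" "compact_op (p * (1 - q))" for p p' q q' :: bop
  proof -
    have "p' * (1 - q') = p * (1 - q) + (- (p - p') * (1 - q) + p' * (q - q'))"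
      by (simp add: algebra_simps)
    then show ?thesis
      using that
      by (simp only: compact_op_add compact_op_mult_left compact_op_mult_right compact_op_uminus)
  qed
  fix p p' q q' :: bop
  assume "compact_op (p - p')" "compact_op (q - q')"
  moreover from this have "compact_op (p' - p)" "compact_op (q' - q)"
    by (metis compact_op_uminus minus_diff_eq)+
  ultimately show "compact_op (p * (1 - q)) = compact_op (p' * (1 - q'))"
    using * by blast
qed

text \<open>The join is a relation, so that no completeness of the order is presupposed:
  \<open>is_join X s\<close> says that \<open>X\<close> has a least upper bound among the projections and that it is \<open>s\<close>.\<close>

definition is_join :: "calkin set \<Rightarrow> calkin \<Rightarrow> bool" where
  "is_join X s \<longleftrightarrow> s \<in> calkin_projections \<and> (\<forall>x\<in>X. calkin_le x s) \<and>
     (\<forall>y\<in>calkin_projections. (\<forall>x\<in>X. calkin_le x y) \<longrightarrow> calkin_le s y)"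


section \<open>Martin's Axiom\<close>

text \<open>\<open>(p, q) \<in> r\<close> means \<open>p \<le> q\<close>, that is, \<open>p\<close> extends \<open>q\<close>.\<close>

definition compatible_in :: "'a set \<Rightarrow> 'a rel \<Rightarrow> 'a \<Rightarrow> 'a \<Rightarrow> bool" where
  "compatible_in P r p q \<longleftrightarrow> (\<exists>s\<in>P. (s, p) \<in> r \<and> (s, q) \<in> r)"

definition ccc :: "'a set \<Rightarrow> 'a rel \<Rightarrow> bool" where
  "ccc P r \<longleftrightarrow>
     (\<forall>C\<subseteq>P. (\<forall>p\<in>C. \<forall>q\<in>C. p \<noteq> q \<longrightarrow> \<not> compatible_in P r p q) \<longrightarrow> countable C)"

definition dense_subset :: "'a set \<Rightarrow> 'a rel \<Rightarrow> 'a set \<Rightarrow> bool" where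
  "dense_subset P r D \<longleftrightarrow> D \<subseteq> P \<and> (\<forall>p\<in>P. \<exists>d\<in>D. (d, p) \<in> r)"

definition poset_filter :: "'a set \<Rightarrow> 'a rel \<Rightarrow> 'a set \<Rightarrow> bool" where
  "poset_filter P r G \<longleftrightarrow> G \<subseteq> P \<and> G \<noteq> {} \<and>
     (\<forall>p\<in>G. \<forall>q\<in>P. (p, q) \<in> r \<longrightarrow> q \<in> G) \<and>
     (\<forall>p\<in>G. \<forall>q\<in>G. \<exists>s\<in>G. (s, p) \<in> r \<and> (s, q) \<in> r)"

text \<open>HOL cannot quantify over all posets of all types. The axiom is stated for posets whose
  underlying set is a set of subsets of \<open>\<nat>\<close>, i.e. (up to isomorphism) for all posets of size at most
  $2^{\aleph_0}$. Nothing is lost: by the usual Loewenheim-Skolem argument, Martin's Axiom for such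
  posets implies it for all posets.\<close>

definition martins_axiom :: bool where
  "martins_axiom \<longleftrightarrow>
     (\<forall>(P :: nat set set) r. P \<noteq> {} \<and> partial_order_on P r \<and> ccc P r \<longrightarrow>
       (\<forall>\<D>. |\<D>| <o |UNIV :: nat set set| \<and> (\<forall>D\<in>\<D>. dense_subset P r D) \<longrightarrow>
         (\<exists>G. poset_filter P r G \<and> (\<forall>D\<in>\<D>. G \<inter> D \<noteq> {}))))"

end

(*
If the join of the classes of a finite F is not 1, then some noncompact T has qT compact for all q in F
(T = 1 - Y for an upper bound Y). Modulo the finite rank part of T this yields, beyond any
coordinate, a finitely supported vector v with rational coordinates on which all q in F are small
relative to |v|; otherwise T would be dominated by the compact operators qT, hence compact.
Force with pairs (s, F), where s is a finite sequence of such vectors with successive supports, F is a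
finite subset of A, and the vectors added to s later satisfy |q v_n| <= 2^-n |v_n| for q in F. Only
countably many sequences s exist, so the order is sigma-centered, and fewer than continuum many dense
sets make every q in A appear. The projection p onto the closed span of the generic sequence has pq
compact, since pq is a norm limit of finite rank operators.
*)
theory Submission
  imports Defs
begin

section \<open>Generic sequences from Martin's Axiom\<close>

lemma martins_axiomD:
  fixes e :: "'a \<Rightarrow> nat set"
  assumes "martins_axiom" and e: "inj_on e P" and "P \<noteq> {}"
    and po: "partial_order_on P r" and "ccc P r"
    and "|\<D>| <o |UNIV :: nat set set|" and dense: "\<And>D. D \<in> \<D> \<Longrightarrow> dense_subset P r D"
  obtains G where "poset_filter P r G" "\<forall>D\<in>\<D>. G \<inter> D \<noteq> {}"
proof -
  define r' where "r' = map_prod e e ` r"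
  have rP: "r \<subseteq> P \<times> P" and rrefl: "\<And>x. x \<in> P \<Longrightarrow> (x, x) \<in> r" and rtr: "trans r" and ras: "antisym r"
    using partial_order_onD[OF po] by (auto simp: refl_on_def)
  have r'_iff: "(e x, e y) \<in> r' \<longleftrightarrow> (x, y) \<in> r" if "x \<in> P" "y \<in> P" for x y
  proof
    assume "(e x, e y) \<in> r'"
    then obtain x' y' where xy: "(x', y') \<in> r" "e x = e x'" "e y = e y'"
      by (auto simp: r'_def)
    moreover have "x = x'" "y = y'"
      using xy rP that inj_onD[OF e] by blast+
    ultimately show "(x, y) \<in> r" by simp
  qed (auto simp: r'_def)
  have compat: "compatible_in (e ` P) r' (e x) (e y) \<longleftrightarrow> compatible_in P r x y"
    if "x \<in> P" "y \<in> P" for x y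
    using that by (auto simp: compatible_in_def r'_iff)
  have "partial_order_on (e ` P) r'"
    unfolding partial_order_on_def preorder_on_def
  proof (intro conjI)
    show "r' \<subseteq> e ` P \<times> e ` P"
      using rP by (auto simp: r'_def)
    show "refl_on (e ` P) r'"
      by (auto simp: refl_on_def r'_iff rrefl)
    show "trans r'"
    proof (rule transI)
      fix x y z assume xy: "(x, y) \<in> r'" "(y, z) \<in> r'"
      then have "x \<in> e ` P" "y \<in> e ` P" "z \<in> e ` P"
        using \<open>r' \<subseteq> e ` P \<times> e ` P\<close> by auto
      then obtain x' y' z' where "x = e x'" "y = e y'" "z = e z'" "x' \<in> P" "y' \<in> P" "z' \<in> P"
        by blast
      then show "(x, z) \<in> r'"
        using xy transD[OF rtr] by (auto simp: r'_iff)
    qed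
    show "antisym r'"
    proof (rule antisymI)
      fix x y assume xy: "(x, y) \<in> r'" "(y, x) \<in> r'"
      then have "x \<in> e ` P" "y \<in> e ` P"
        using \<open>r' \<subseteq> e ` P \<times> e ` P\<close> by auto
      then obtain x' y' where "x = e x'" "y = e y'" "x' \<in> P" "y' \<in> P"
        by blast
      then show "x = y"
        using xy antisymD[OF ras] by (auto simp: r'_iff)
    qed
  qed
  moreover have "ccc (e ` P) r'"
    unfolding ccc_def
  proof (intro allI impI)
    fix C assume C: "C \<subseteq> e ` P" and anti: "\<forall>p\<in>C. \<forall>q\<in>C. p \<noteq> q \<longrightarrow> \<not> compatible_in (e ` P) r' p q"
    obtain C' where C': "C' \<subseteq> P" "C = e ` C'"
      using C by (meson subset_imageE)
    have "\<forall>p\<in>C'. \<forall>q\<in>C'. p \<noteq> q \<longrightarrow> \<not> compatible_in P r p q"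
    proof (intro ballI impI)
      fix p q assume pq: "p \<in> C'" "q \<in> C'" "p \<noteq> q"
      then have "e p \<noteq> e q"
        using inj_onD[OF e] C' by blast
      then show "\<not> compatible_in P r p q"
        using anti pq C' compat[of p q] by blast
    qed
    then have "countable C'"
      using \<open>ccc P r\<close> C' unfolding ccc_def by blast
    then show "countable C" using C' by blast
  qed
  moreover have "|(`) e ` \<D>| <o |UNIV :: nat set set|"
    using card_of_image assms(6) ordLeq_ordLess_trans by blast
  moreover have "dense_subset (e ` P) r' D" if D: "D \<in> (`) e ` \<D>" for D
  proof -
    obtain D' where D': "D = e ` D'" "dense_subset P r D'"
      using D dense by blast
    then show ?thesis
      unfolding dense_subset_def by (fastforce simp: r'_iff subset_iff)
  qed
  ultimately obtain G where G: "poset_filter (e ` P) r' G" "\<And>D. D \<in> \<D> \<Longrightarrow> G \<inter> e ` D \<noteq> {}"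
    using \<open>martins_axiom\<close> \<open>P \<noteq> {}\<close> unfolding martins_axiom_def
    by (metis (no_types, lifting) image_eqI image_is_empty)
  define H where "H = {x \<in> P. e x \<in> G}"
  have HG: "G = e ` H"
    using G(1) unfolding poset_filter_def H_def by blast
  have HP: "H \<subseteq> P" by (auto simp: H_def)
  show thesis
  proof
    show "poset_filter P r H"
      unfolding poset_filter_def
    proof (intro conjI ballI impI)
      show "H \<subseteq> P" "H \<noteq> {}"
        using HP HG G(1) by (auto simp: poset_filter_def)
      show "q \<in> H" if "p \<in> H" "q \<in> P" "(p, q) \<in> r" for p q
        using that G(1) r'_iff[of p q] unfolding poset_filter_def H_def by blast
      show "\<exists>s\<in>H. (s, p) \<in> r \<and> (s, q) \<in> r" if pq: "p \<in> H" "q \<in> H" for p q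
      proof -
        have "e p \<in> G" "e q \<in> G" using pq HG by auto
        then obtain s' where "s' \<in> G" "(s', e p) \<in> r'" "(s', e q) \<in> r'"
          using G(1) unfolding poset_filter_def by blast
        then show ?thesis
          unfolding HG using pq HP r'_iff by blast
      qed
    qed
    have "H \<inter> D \<noteq> {}" if D: "D \<in> \<D>" for D
    proof -
      have "D \<subseteq> P" using dense[OF D] by (simp add: dense_subset_def)
      moreover obtain x where "x \<in> D" "e x \<in> G" using G(2)[OF D] by blast
      ultimately show ?thesis by (auto simp: H_def)
    qed
    then show "\<forall>D\<in>\<D>. H \<inter> D \<noteq> {}" by blast
  qed
qed

section \<open>Coding conditions by sets of natural numbers\<close>

lemma inj_list_of_sets_code:
  "inj (\<lambda>xs :: nat set list. insert (prod_encode (0, length xs))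
     {prod_encode (Suc i, k) | i k. i < length xs \<and> k \<in> xs ! i})" (is "inj ?f")
proof (rule injI)
  fix xs ys :: "nat set list" assume eq: "?f xs = ?f ys"
  \<comment> \<open>Codes with first component 0 record the length, those with first component
    \<open>Suc i\<close> the i-th set, so both can be read off.\<close>
  have len: "prod_encode (0, n) \<in> ?f zs \<longleftrightarrow> n = length zs" for n and zs :: "nat set list"
    by auto
  have mem: "prod_encode (Suc i, k) \<in> ?f zs \<longleftrightarrow> i < length zs \<and> k \<in> zs ! i" for i k
    and zs :: "nat set list"
    by auto
  have "length xs = length ys"
    using len[of "length xs" xs] len[of "length xs" ys] eq by simp
  moreover have "xs ! i = ys ! i" if "i < length xs" for i
  proof -
    have "k \<in> xs ! i \<longleftrightarrow> k \<in> ys ! i" for k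
      using mem[of i k xs] mem[of i k ys] that calculation unfolding eq by simp
    then show ?thesis by blast
  qed
  ultimately show "xs = ys" by (simp add: nth_equalityI)
qed

text \<open>Supplies the injection that \<open>martins_axiomD\<close> asks for. A finite subset of
  \<open>A\<close> is enumerated, its members are replaced by their codes, and the countable
  component is put in front as a singleton.\<close>

lemma inj_on_countable_times_finite_sets:
  fixes A :: "'a set"
  assumes "|A| \<le>o |UNIV :: nat set set|"
  obtains e :: "'c::countable \<times> 'a set \<Rightarrow> nat set"
  where "inj_on e (UNIV \<times> {F. finite F \<and> F \<subseteq> A})"
proof -
  obtain f :: "'a \<Rightarrow> nat set" where f: "inj_on f A"
    using assms card_of_ordLeq[of A "UNIV :: nat set set"] by blast
  obtain h :: "nat set list \<Rightarrow> nat set" where h: "inj h"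
    using inj_list_of_sets_code by blast
  define l where "l F = (SOME xs. set xs = F)" for F :: "'a set"
  have l: "set (l F) = F" if "finite F" for F
    unfolding l_def using someI_ex[OF finite_list[OF that]] .
  define e where "e = (\<lambda>(c :: 'c, F). h ({to_nat c} # map f (l F)))"
  have "inj_on e (UNIV \<times> {F. finite F \<and> F \<subseteq> A})"
  proof (rule inj_onI, clarsimp simp: e_def)
    fix c c' :: 'c and F F' assume F: "finite F" "F \<subseteq> A" "finite F'" "F' \<subseteq> A"
      and "h ({to_nat (c :: 'c)} # map f (l F)) = h ({to_nat c'} # map f (l F'))"
    then have "to_nat c = to_nat c'" "map f (l F) = map f (l F')"
      using injD[OF h] by blast+
    moreover from this(2) have "f ` F = f ` F'"
      using l F by (metis set_map)
    ultimately show "c = c' \<and> F = F'"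
      using F f by (simp add: inj_on_image_eq_iff)
  qed
  then show thesis by (rule that)
qed

lemma countable_ordLess_nat_set: "countable X \<Longrightarrow> |X| <o |UNIV :: nat set set|"
proof -
  assume "countable X"
  then have "|X| \<le>o |UNIV :: nat set|"
    by (metis countable_def card_of_ordLeq subset_UNIV)
  then show ?thesis
    using card_of_Pow[of "UNIV :: nat set"] ordLeq_ordLess_trans by auto
qed

section \<open>The forcing order of finite sequences with finite promises\<close>

definition seq_conds :: "('c list \<Rightarrow> 'c \<Rightarrow> bool) \<Rightarrow> 'a set \<Rightarrow> ('c list \<times> 'a set) set" where
  "seq_conds S A = {(s, F). (\<forall>i<length s. S (take i s) (s ! i)) \<and> finite F \<and> F \<subseteq> A}"

text \<open>\<open>S s c\<close> means that \<open>c\<close> may follow \<open>s\<close>;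
  \<open>R q s c\<close> means that doing so respects the requirement of \<open>q\<close>. As in
  Mathias forcing, the finite set of a condition is a promise about entries appended later. Entries
  already present are not tested against it, so a promise can be enlarged at any time.\<close>

definition seq_ext ::
  "('c list \<Rightarrow> 'c \<Rightarrow> bool) \<Rightarrow> ('a \<Rightarrow> 'c list \<Rightarrow> 'c \<Rightarrow> bool) \<Rightarrow> 'a set \<Rightarrow> ('c list \<times> 'a set) rel" where
  "seq_ext S R A = {((s, F), (t, G)). (s, F) \<in> seq_conds S A \<and> (t, G) \<in> seq_conds S A \<and>
     take (length t) s = t \<and> G \<subseteq> F \<and>
     (\<forall>i q. length t \<le> i \<longrightarrow> i < length s \<longrightarrow> q \<in> G \<longrightarrow> R q (take i s) (s ! i))}"

lemma partial_order_seq_ext: "partial_order_on (seq_conds S A) (seq_ext S R A)"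
  unfolding partial_order_on_def preorder_on_def
proof (intro conjI)
  show "seq_ext S R A \<subseteq> seq_conds S A \<times> seq_conds S A"
    by (auto simp: seq_ext_def)
  show "refl_on (seq_conds S A) (seq_ext S R A)"
    by (auto simp: refl_on_def seq_ext_def)
  have "s = t" if "take (length t) s = t" "take (length s) t = s" for s t :: "'a list"
    using that by (metis length_take min.cobounded1 take_all)
  then show "antisym (seq_ext S R A)"
    by (fastforce simp: antisym_def seq_ext_def)
  show "trans (seq_ext S R A)"
  proof (rule transI, clarsimp simp: seq_ext_def, intro conjI allI impI)
    fix s t u :: "'a list" and F G H :: "'b set"
    assume st: "take (length t) s = t" and tu: "take (length u) t = u" and GF: "G \<subseteq> F" "H \<subseteq> G"
      and RG: "\<forall>i\<ge>length t. i < length s \<longrightarrow> (\<forall>q. q \<in> G \<longrightarrow> R q (take i s) (s ! i))"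
      and RH: "\<forall>i\<ge>length u. i < length t \<longrightarrow> (\<forall>q. q \<in> H \<longrightarrow> R q (take i t) (t ! i))"
    have len: "length u \<le> length t" using tu by (metis length_take min.cobounded2 min.commute)
    show "take (length u) s = u"
      using st tu len by (metis min.absorb1 take_take)
    fix i q assume i: "length u \<le> i" "i < length s" "q \<in> H"
    show "R q (take i s) (s ! i)"
    \<comment> \<open>Entries inside \<open>t\<close> were tested when \<open>t\<close> extended
      \<open>u\<close>; the later ones were tested against \<open>G\<close>, which contains
      \<open>H\<close>.\<close>
    proof (cases "i < length t")
      case True
      then have "take i s = take i t" "s ! i = t ! i"
        using st by (metis min.absorb1 less_imp_le take_take, metis nth_take)
      then show ?thesis using RH i True by auto
    next
      case False
      then show ?thesis using RG i GF by auto
    qed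
  qed auto
qed

text \<open>Conditions with the same first component are compatible, so the order is \<open>\<sigma>\<close>-centered.\<close>

lemma ccc_seq_ext: "ccc (seq_conds S A) (seq_ext S R A :: ('c::countable list \<times> 'a set) rel)"
  unfolding ccc_def
proof (intro allI impI)
  fix C assume C: "C \<subseteq> seq_conds S A"
    and anti: "\<forall>p\<in>C. \<forall>q\<in>C. p \<noteq> q \<longrightarrow> \<not> compatible_in (seq_conds S A) (seq_ext S R A) p q"
  have "inj_on fst C"
  proof (rule inj_onI, rule ccontr)
    fix p q assume pq: "p \<in> C" "q \<in> C" "fst p = fst q" "p \<noteq> q"
    obtain s F G where "p = (s, F)" "q = (s, G)" using pq(3) by (metis prod.collapse)
    moreover from this have "(s, F) \<in> seq_conds S A" "(s, G) \<in> seq_conds S A" using C pq by auto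
    ultimately have "compatible_in (seq_conds S A) (seq_ext S R A) p q"
      unfolding compatible_in_def
      by (intro bexI[of _ "(s, F \<union> G)"]) (auto simp: seq_ext_def seq_conds_def)
    then show False using anti pq by blast
  qed
  moreover have "countable (fst ` C)" by simp
  ultimately show "countable C" using countable_image_inj_on by blast
qed

text \<open>All use of forcing is confined here: to construct a sequence it then suffices to solve
  the one-step problem \<open>step\<close> for finitely many requirements. Meeting the sets
  \<open>L n\<close> makes the generic sequence infinite; meeting \<open>M q\<close> puts
  \<open>q\<close> into a promise, after which every new entry respects it.\<close>

lemma martins_axiom_sequence:
  fixes S :: "'c::countable list \<Rightarrow> 'c \<Rightarrow> bool" and R :: "'a \<Rightarrow> 'c list \<Rightarrow> 'c \<Rightarrow> bool"
  assumes MA: "martins_axiom" and A: "|A| <o |UNIV :: nat set set|"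
    and step: "\<And>s F. finite F \<Longrightarrow> F \<subseteq> A \<Longrightarrow> \<exists>c. S s c \<and> (\<forall>q\<in>F. R q s c)"
  obtains g :: "nat \<Rightarrow> 'c" where "\<And>n. S (map g [0..<n]) (g n)"
    "\<And>q. q \<in> A \<Longrightarrow> \<exists>N. \<forall>n\<ge>N. R q (map g [0..<n]) (g n)"
proof -
  let ?P = "seq_conds S A" and ?r = "seq_ext S R A"
  obtain e :: "'c list \<times> 'a set \<Rightarrow> nat set" where "inj_on e (UNIV \<times> {F. finite F \<and> F \<subseteq> A})"
    using inj_on_countable_times_finite_sets ordLess_imp_ordLeq[OF A] by blast
  then have e: "inj_on e ?P"
    by (rule inj_on_subset) (auto simp: seq_conds_def)
  define L where "L n = {(s, F) \<in> ?P. n \<le> length s}" for n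
  define M where "M q = {(s, F) \<in> ?P. q \<in> F}" for q
  \<comment> \<open>Countably many length requirements and at most as many promise requirements as
    \<open>A\<close> has elements.\<close>
  have card: "|range L \<union> M ` A| <o |UNIV :: nat set set|"
  proof (rule card_of_Un_ordLess_infinite)
    show "infinite (UNIV :: nat set set)"
      by (simp add: Finite_Set.finite_set)
    show "|range L| <o |UNIV :: nat set set|"
      by (rule countable_ordLess_nat_set) simp
    show "|M ` A| <o |UNIV :: nat set set|"
      using card_of_image A ordLeq_ordLess_trans by blast
  qed
  have denseL: "dense_subset ?P ?r (L n)" for n
  proof -
    have *: "\<exists>s' F'. (s', F') \<in> L n \<and> ((s', F'), (s, F)) \<in> ?r" if "(s, F) \<in> ?P" for s F
    proof (induction n)
      case 0
      show ?case using that by (intro exI[of _ s] exI[of _ F]) (auto simp: L_def seq_ext_def)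
    next
      case (Suc n)
      then obtain s' F' where s': "(s', F') \<in> L n" "((s', F'), (s, F)) \<in> ?r" by blast
      then have P: "(s', F') \<in> ?P" and n: "n \<le> length s'" by (auto simp: L_def)
      \<comment> \<open>The promise \<open>F'\<close> is finite, so \<open>step\<close> yields a
        single entry that honours all of it.\<close>
      then obtain c where c: "S s' c" "\<forall>q\<in>F'. R q s' c"
        using step[of F' s'] by (auto simp: seq_conds_def)
      have "(s' @ [c], F') \<in> L (Suc n)"
        using P n c by (auto simp: L_def seq_conds_def nth_append not_less_eq not_less elim!: less_SucE)
      moreover from this have "((s' @ [c], F'), (s', F')) \<in> ?r"
        using P c by (auto simp: L_def seq_ext_def dest: le_antisym)
      ultimately show ?case
        using s'(2) partial_order_onD(2)[OF partial_order_seq_ext] by (meson transD)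
    qed
    then show ?thesis by (fastforce simp: dense_subset_def L_def)
  qed
  have denseM: "dense_subset ?P ?r (M q)" if "q \<in> A" for q
  proof -
    \<comment> \<open>No entry is appended, so the clause on \<open>R\<close> is vacuous.\<close>
    have "(s, insert q F) \<in> M q \<and> ((s, insert q F), (s, F)) \<in> ?r" if "(s, F) \<in> ?P" for s F
      using that \<open>q \<in> A\<close> by (auto simp: M_def seq_conds_def seq_ext_def)
    then show ?thesis by (fastforce simp: dense_subset_def M_def)
  qed
  have "([], {}) \<in> ?P" by (simp add: seq_conds_def)
  then have ne: "?P \<noteq> {}" by blast
  have dense: "dense_subset ?P ?r D" if "D \<in> range L \<union> M ` A" for D
    using that denseL denseM by blast
  obtain G where G: "poset_filter ?P ?r G"
    and GD: "\<forall>D\<in>range L \<union> M ` A. G \<inter> D \<noteq> {}"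
    by (rule martins_axiomD[OF MA e ne partial_order_seq_ext ccc_seq_ext card dense])
  have GP: "(s, F) \<in> G \<Longrightarrow> (s, F) \<in> ?P" for s F
    using G by (auto simp: poset_filter_def)
  have dir: "\<exists>u H. (u, H) \<in> G \<and> ((u, H), (s, F)) \<in> ?r \<and> ((u, H), (s', F')) \<in> ?r"
    if "(s, F) \<in> G" "(s', F') \<in> G" for s F s' F'
    using G that unfolding poset_filter_def by fast
  have long: "\<exists>s F. (s, F) \<in> G \<and> n < length s" for n
    using bspec[OF GD, of "L (Suc n)"] by (auto simp: L_def)
  \<comment> \<open>The choice is immaterial: two conditions in \<open>G\<close> have a common
    extension, so their sequences agree wherever both are defined.\<close>
  define g where "g n = (SOME c. \<exists>s F. (s, F) \<in> G \<and> n < length s \<and> c = s ! n)" for n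
  have g: "s ! n = g n" if s: "(s, F) \<in> G" "n < length s" for s F n
  proof -
    have "\<exists>c s F. (s, F) \<in> G \<and> n < length s \<and> c = s ! n"
      using s by blast
    from someI_ex[OF this] obtain s' F' where s': "(s', F') \<in> G" "n < length s'" "g n = s' ! n"
      unfolding g_def by blast
    obtain u H where "((u, H), (s, F)) \<in> ?r" "((u, H), (s', F')) \<in> ?r"
      using dir[OF s(1) s'(1)] by blast
    then have "take (length s) u = s" "take (length s') u = s'"
      by (auto simp: seq_ext_def)
    then show ?thesis
      using s s' nth_take[of n "length s" u] nth_take[of n "length s'" u] by simp
  qed
  have take_g: "take n s = map g [0..<n]" if "(s, F) \<in> G" "n \<le> length s" for s F n
    using that g[OF that(1)] by (auto intro!: nth_equalityI)
  show thesis
  proof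
    show "S (map g [0..<n]) (g n)" for n
    proof -
      obtain s F where s: "(s, F) \<in> G" "n < length s" using long by blast
      then have "S (take n s) (s ! n)" using GP by (auto simp: seq_conds_def)
      then show ?thesis using s take_g[OF s(1)] g[OF s] by simp
    qed
    show "\<exists>N. \<forall>n\<ge>N. R q (map g [0..<n]) (g n)" if q: "q \<in> A" for q
    proof -
      obtain t F where t: "(t, F) \<in> G" "q \<in> F" using bspec[OF GD, of "M q"] q by (auto simp: M_def)
      \<comment> \<open>The condition \<open>(t, F)\<close> promises \<open>q\<close>. A common
        extension with a condition longer than \<open>n\<close> contains the n-th entry, appended
        after \<open>t\<close> and hence bound by the promise.\<close>
      have "R q (map g [0..<n]) (g n)" if n: "n \<ge> length t" for n
      proof -
        obtain s F' where s: "(s, F') \<in> G" "n < length s" using long by blast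
        obtain u H where u: "(u, H) \<in> G" "((u, H), (s, F')) \<in> ?r" "((u, H), (t, F)) \<in> ?r"
          using dir[OF s(1) t(1)] by blast
        have "take (length s) u = s" using u by (simp add: seq_ext_def)
        then have "n < length u" using s by (metis length_take min_less_iff_conj)
        then have "R q (take n u) (u ! n)" using u(3) n t by (auto simp: seq_ext_def)
        then show ?thesis using take_g[OF u(1)] g[OF u(1)] \<open>n < length u\<close> by simp
      qed
      then show ?thesis by blast
    qed
  qed
qed
section \<open>The Hilbert space\<close>

lemmas coord_simps [simp] = zero_ell2.rep_eq plus_ell2.rep_eq uminus_ell2.rep_eq minus_ell2.rep_eq
  scaleR_ell2.rep_eq scaleC.rep_eq

lemma ell2_eqI: "(\<And>n. coord x n = coord y n) \<Longrightarrow> x = y"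
  by (simp add: coord_inject[symmetric] fun_eq_iff)

lemma norm_sq_ell2: "(norm x)\<^sup>2 = (\<Sum>n. (cmod (coord x n))\<^sup>2)"
  unfolding norm_ell2_def by (simp add: suminf_nonneg summable_coord)

lemma cmod_coord_le: "cmod (coord x n) \<le> norm x"
proof -
  have "(cmod (coord x n))\<^sup>2 \<le> (norm x)\<^sup>2"
    using sum_le_suminf[OF summable_coord, of "{n}" x] by (simp add: norm_sq_ell2)
  then show ?thesis by (simp add: power2_le_iff_abs_le)
qed

text \<open>A Cauchy sequence converges in each coordinate. The Cauchy estimate for finite partial
  sums passes to the limit in the second index with a bound independent of the number of terms; this
  shows both that the limit is square summable and that convergence holds in norm.\<close>

instance ell2 :: banach
proof
  fix X :: "nat \<Rightarrow> ell2" assume X: "Cauchy X"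
  have "Cauchy (\<lambda>k. coord (X k) n)" for n
  proof (rule metric_CauchyI)
    fix e :: real assume "e > 0"
    then obtain M where M: "\<And>k l. k \<ge> M \<Longrightarrow> l \<ge> M \<Longrightarrow> dist (X k) (X l) < e"
      using X by (meson metric_CauchyD)
    have "dist (coord (X k) n) (coord (X l) n) \<le> dist (X k) (X l)" for k l
      using cmod_coord_le[of "X k - X l" n] by (simp add: dist_norm)
    then show "\<exists>M. \<forall>k\<ge>M. \<forall>l\<ge>M. dist (coord (X k) n) (coord (X l) n) < e"
      using M by (meson le_less_trans)
  qed
  then obtain y where y: "\<And>n. (\<lambda>k. coord (X k) n) \<longlonglongrightarrow> y n"
    by (meson Cauchy_convergent convergent_def)
  have bound: "\<exists>M. \<forall>k\<ge>M. \<forall>N. (\<Sum>n<N. (cmod (coord (X k) n - y n))\<^sup>2) \<le> e\<^sup>2" if e: "e > 0" for e :: real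
  proof -
    obtain M where M: "\<And>k l. k \<ge> M \<Longrightarrow> l \<ge> M \<Longrightarrow> dist (X k) (X l) < e"
      using metric_CauchyD[OF X e] by blast
    have "(\<Sum>n<N. (cmod (coord (X k) n - y n))\<^sup>2) \<le> e\<^sup>2" if k: "k \<ge> M" for k N
    proof (rule LIMSEQ_le_const2)
      show "(\<lambda>l. \<Sum>n<N. (cmod (coord (X k) n - coord (X l) n))\<^sup>2) \<longlonglongrightarrow>
          (\<Sum>n<N. (cmod (coord (X k) n - y n))\<^sup>2)"
        by (intro tendsto_intros y)
      have "(\<Sum>n<N. (cmod (coord (X k) n - coord (X l) n))\<^sup>2) \<le> e\<^sup>2" if "l \<ge> M" for l
      proof -
        have "(\<Sum>n<N. (cmod (coord (X k) n - coord (X l) n))\<^sup>2) \<le> (norm (X k - X l))\<^sup>2"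
          using sum_le_suminf[OF summable_coord, of "{..<N}" "X k - X l"] by (simp add: norm_sq_ell2)
        also have "\<dots> \<le> e\<^sup>2"
          using M[OF k that] by (intro power_mono) (auto simp: dist_norm)
        finally show ?thesis .
      qed
      then show "\<exists>L. \<forall>l\<ge>L. (\<Sum>n<N. (cmod (coord (X k) n - coord (X l) n))\<^sup>2) \<le> e\<^sup>2" by blast
    qed
    then show ?thesis by blast
  qed
  have sum_diff: "summable (\<lambda>n. (cmod (coord (X k) n - y n))\<^sup>2)"
    if "\<forall>N. (\<Sum>n<N. (cmod (coord (X k) n - y n))\<^sup>2) \<le> e" for k e
    using that[rule_format, of "Suc _"]
    by (intro bounded_imp_summable[of _ e]) (auto simp only: lessThan_Suc_atMost zero_le_power2)
  obtain K where "\<forall>N. (\<Sum>n<N. (cmod (coord (X K) n - y n))\<^sup>2) \<le> 1\<^sup>2"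
    using bound[of 1] by auto
  \<comment> \<open>The limit \<open>y\<close> is written as \<open>X K\<close> minus the square
    summable difference \<open>X K - y\<close>.\<close>
  then have "summable (\<lambda>n. (cmod (coord (X K) n + - (coord (X K) n - y n)))\<^sup>2)"
    using sum_diff[of K] summable_sq_add[of "coord (X K)" "\<lambda>n. - (coord (X K) n - y n)"] summable_coord
    by (simp add: norm_minus_commute)
  then have Y: "coord (Abs_ell2 y) = y"
    by (intro Abs_ell2_inverse) simp
  have "X \<longlonglongrightarrow> Abs_ell2 y"
  proof (rule metric_LIMSEQ_I)
    fix e :: real assume e: "e > 0"
    then obtain M where M: "\<forall>k\<ge>M. \<forall>N. (\<Sum>n<N. (cmod (coord (X k) n - y n))\<^sup>2) \<le> (e / 2)\<^sup>2"
      using bound[of "e / 2"] by auto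
    have "dist (X k) (Abs_ell2 y) < e" if "k \<ge> M" for k
    proof -
      have "(norm (X k - Abs_ell2 y))\<^sup>2 \<le> (e / 2)\<^sup>2"
        unfolding norm_sq_ell2 using M that by (intro suminf_le_const summable_coord) (simp add: Y)
      then have "norm (X k - Abs_ell2 y) \<le> e / 2"
        using e by (simp add: power2_le_iff_abs_le)
      then show ?thesis using e by (simp add: dist_norm)
    qed
    then show "\<exists>M. \<forall>k\<ge>M. dist (X k) (Abs_ell2 y) < e" by blast
  qed
  then show "convergent X" by (rule convergentI)
qed

section \<open>Complex scalars and the complex inner product\<close>

lemma scaleC_add_left: "scaleC (a + b) x = scaleC a x + scaleC b x"
  by (rule ell2_eqI) (simp add: algebra_simps)

lemma scaleC_diff_left: "scaleC (a - b) x = scaleC a x - scaleC b x"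
  by (rule ell2_eqI) (simp add: algebra_simps)

lemma scaleC_scaleC [simp]: "scaleC a (scaleC b x) = scaleC (a * b) x"
  by (rule ell2_eqI) simp

lemma scaleC_of_real: "scaleC (of_real r) x = r *\<^sub>R x"
  by (rule ell2_eqI) simp

lemma scaleC_simps [simp]: "scaleC 1 x = x" "scaleC 0 x = 0"
  by (rule ell2_eqI; simp)+

lemma norm_scaleC [simp]: "norm (scaleC c x) = cmod c * norm x"
proof -
  have "(norm (scaleC c x))\<^sup>2 = (cmod c * norm x)\<^sup>2"
    by (simp add: norm_sq_ell2 power_mult_distrib norm_mult suminf_mult summable_coord)
  then show ?thesis by (simp add: power2_eq_iff_nonneg)
qed

lemma scaleC_scaleR: "scaleC c (r *\<^sub>R x) = r *\<^sub>R scaleC c x" "scaleC (r *\<^sub>R c) x = r *\<^sub>R scaleC c x"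
  by (rule ell2_eqI; simp add: scaleR_conv_of_real)+

lemma bounded_linear_scaleC_right: "bounded_linear (scaleC c)"
  by (rule bounded_linear_intro[of _ "cmod c"]) (simp_all add: scaleC_add_right scaleC_scaleR)

lemma bounded_linear_scaleC_left: "bounded_linear (\<lambda>c. scaleC c x)"
  by (rule bounded_linear_intro[of _ "norm x"]) (simp_all add: scaleC_add_left scaleC_scaleR)

lemma cinner_add_left: "cinner (x + y) z = cinner x z + cinner y z"
  unfolding cinner_def suminf_add[OF summable_cinner summable_cinner] by (simp add: algebra_simps)

lemma cinner_scaleC_left: "cinner (scaleC c x) y = c * cinner x y"
  unfolding cinner_def suminf_mult[OF summable_cinner, symmetric] by (simp add: algebra_simps)

lemma cnj_cinner: "cnj (cinner x y) = cinner y x"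
proof -
  have "(\<lambda>n. coord x n * cnj (coord y n)) sums cinner x y"
    unfolding cinner_def by (rule summable_sums[OF summable_cinner])
  then have "(\<lambda>n. cnj (coord x n * cnj (coord y n))) sums cnj (cinner x y)"
    by (simp only: sums_cnj)
  then show ?thesis unfolding cinner_def by (simp add: sums_iff mult.commute)
qed

lemma cinner_scaleC_right: "cinner x (scaleC c y) = cnj c * cinner x y"
  by (metis cinner_scaleC_left cnj_cinner complex_cnj_mult)

lemma cinner_self: "cinner x x = of_real ((norm x)\<^sup>2)"
proof (rule complex_eqI)
  show "Re (cinner x x) = Re (of_real ((norm x)\<^sup>2))"
    by (simp add: inner_ell2_def[symmetric] power2_norm_eq_inner)
  show "Im (cinner x x) = Im (of_real ((norm x)\<^sup>2))"
    using arg_cong[OF cnj_cinner[of x x], of Im] by simp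
qed

text \<open>Multiplying \<open>x\<close> by a phase \<open>c\<close> makes the inner product real
  and nonnegative without changing the norm, which reduces the claim to the real Cauchy-Schwarz
  inequality.\<close>

lemma cmod_cinner_le: "cmod (cinner x y) \<le> norm x * norm y"
proof (cases "cinner x y = 0")
  case False
  define c where "c = cnj (sgn (cinner x y))"
  have "c * cinner x y = of_real (cmod (cinner x y))"
    unfolding c_def sgn_eq using False complex_norm_square[of "cinner x y"]
    by (simp add: power2_eq_square field_simps)
  then have "cmod (cinner x y) = inner (scaleC c x) y"
    by (simp add: inner_ell2_def cinner_scaleC_left)
  also have "\<dots> \<le> norm (scaleC c x) * norm y"
    by (rule norm_cauchy_schwarz)
  also have "norm (scaleC c x) = norm x"
    using False by (simp add: c_def norm_sgn)
  finally show ?thesis .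
qed simp

lemma bounded_linear_cinner_left: "bounded_linear (\<lambda>x. cinner x y)"
proof (rule bounded_linear_intro[of _ "norm y"])
  show "cinner (r *\<^sub>R x) y = r *\<^sub>R cinner x y" for r x
    by (simp flip: scaleC_of_real add: cinner_scaleC_left scaleR_conv_of_real)
qed (simp_all add: cinner_add_left cmod_cinner_le)

lemma cinner_sum_left: "cinner (sum f I) y = (\<Sum>i\<in>I. cinner (f i) y)"
  by (rule linear_sum[OF bounded_linear.linear[OF bounded_linear_cinner_left]])

lemma bop_exists:
  assumes "bounded_linear f" "\<And>c x. f (scaleC c x) = scaleC c (f x)"
  obtains T where "app T = f"
proof
  have "blinfun_apply (Blinfun f) = f" using assms(1) by (rule bounded_linear_Blinfun_apply)
  then show "app (Abs_bop (Blinfun f)) = f"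
    using assms(2) by (simp add: app.rep_eq Abs_bop_inverse)
qed

lemmas app_diff = linear_diff[OF bounded_linear.linear[OF bounded_linear_app]]

lemma app_scaleC: "app T (scaleC c x) = scaleC c (app T x)"
  by transfer simp

lemma app_sum_left: "app (sum T I) x = (\<Sum>i\<in>I. app (T i) x)"
  by (induction I rule: infinite_finite_induct) auto

section \<open>The standard basis\<close>

definition basis_vec :: "nat \<Rightarrow> ell2" where
  "basis_vec i = Abs_ell2 (\<lambda>n. if n = i then 1 else 0)"

lemma coord_basis_vec [simp]: "coord (basis_vec i) n = (if n = i then 1 else 0)"
proof -
  have "summable (\<lambda>n. (cmod (if n = i then 1 else 0))\<^sup>2)"
    by (rule summable_finite[of "{i}"]) auto
  then show ?thesis unfolding basis_vec_def by (subst Abs_ell2_inverse) auto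
qed

lemma norm_basis_vec [simp]: "norm (basis_vec i) = 1"
proof -
  have "(norm (basis_vec i))\<^sup>2 = (\<Sum>n\<in>{i}. (cmod (coord (basis_vec i) n))\<^sup>2)"
    unfolding norm_sq_ell2 by (rule suminf_finite) auto
  then show ?thesis using norm_ge_zero[of "basis_vec i"] by (simp add: power2_eq_1_iff)
qed

lemma cinner_basis_vec: "cinner x (basis_vec i) = coord x i"
proof -
  have "cinner x (basis_vec i) = (\<Sum>n\<in>{i}. coord x n * cnj (coord (basis_vec i) n))"
    unfolding cinner_def by (rule suminf_finite) auto
  then show ?thesis by simp
qed

lemma coord_sum: "coord (sum f I) n = (\<Sum>i\<in>I. coord (f i) n)"
  by (induction I rule: infinite_finite_induct) auto

section \<open>Compact operators\<close>

text \<open>Since the space is complete, compactness of the closed image is total boundedness. It is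
  expressed by covers of the unit ball itself, because covers belonging to different operators can
  then be intersected.\<close>

lemma compact_op_iff_cover:
  "compact_op T \<longleftrightarrow> (\<forall>e>0. \<exists>\<C>. finite \<C> \<and> cball 0 1 \<subseteq> \<Union>\<C> \<and>
     (\<forall>U\<in>\<C>. \<forall>x\<in>U. \<forall>y\<in>U. norm (app T (x - y)) < e))" (is "_ \<longleftrightarrow> ?R")
proof
  assume T: "compact_op T"
  show ?R
  proof (intro allI impI)
    fix e :: real assume "e > 0"
    then have "\<exists>k. finite k \<and> closure (app T ` cball 0 1) \<subseteq> (\<Union>z\<in>k. ball z (e / 2))"
      using T[unfolded compact_op_def compact_eq_totally_bounded] by simp
    then obtain k where k: "finite k" "closure (app T ` cball 0 1) \<subseteq> (\<Union>z\<in>k. ball z (e / 2))"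
      by (elim exE conjE)
    \<comment> \<open>Preimages of the balls of radius \<open>e / 2\<close>, whose points have
      images at distance less than \<open>e\<close>.\<close>
    let ?C = "(\<lambda>z. {x. dist z (app T x) < e / 2}) ` k"
    have "cball 0 1 \<subseteq> \<Union>?C"
    proof
      fix x :: ell2 assume "x \<in> cball 0 1"
      then have "app T x \<in> closure (app T ` cball 0 1)"
        by (intro subsetD[OF closure_subset] imageI)
      then obtain z where "z \<in> k" "app T x \<in> ball z (e / 2)"
        using k(2) by blast
      then show "x \<in> \<Union>?C" by (intro UnionI[OF imageI]) simp_all
    qed
    moreover have "norm (app T (x - y)) < e" if "dist z (app T x) < e / 2" "dist z (app T y) < e / 2"
      for x y z
      using dist_triangle_half_r[OF that] by (simp add: dist_norm app_diff)
    then have "\<forall>U\<in>?C. \<forall>x\<in>U. \<forall>y\<in>U. norm (app T (x - y)) < e"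
      by simp
    ultimately have "finite ?C \<and> cball 0 1 \<subseteq> \<Union>?C \<and>
        (\<forall>U\<in>?C. \<forall>x\<in>U. \<forall>y\<in>U. norm (app T (x - y)) < e)"
      using k(1) by (intro conjI finite_imageI)
    then show "\<exists>\<C>. finite \<C> \<and> cball 0 1 \<subseteq> \<Union>\<C> \<and>
        (\<forall>U\<in>\<C>. \<forall>x\<in>U. \<forall>y\<in>U. norm (app T (x - y)) < e)" ..
  qed
next
  assume R: ?R
  let ?S = "app T ` cball 0 1"
  show "compact_op T"
    unfolding compact_op_def compact_eq_totally_bounded
  proof (intro conjI allI impI)
    show "complete (closure ?S)" by (simp add: complete_eq_closed)
    fix e :: real assume e: "e > 0"
    then obtain \<C> where \<C>: "finite \<C>" "cball 0 1 \<subseteq> \<Union>\<C>"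
      and small: "\<forall>U\<in>\<C>. \<forall>x\<in>U. \<forall>y\<in>U. norm (app T (x - y)) < e / 2"
      using R[rule_format, of "e / 2"] by auto
    \<comment> \<open>One centre per piece; an empty piece contributes an arbitrary and harmless
      one.\<close>
    define k where "k = (\<lambda>U. app T (SOME z. z \<in> U)) ` \<C>"
    have "?S \<subseteq> (\<Union>z\<in>k. cball z (e / 2))"
    proof
      fix y assume "y \<in> ?S"
      then obtain x U where x: "y = app T x" "x \<in> U" "U \<in> \<C>" using \<C>(2) by blast
      have "(SOME z. z \<in> U) \<in> U" using x(2) by (rule someI)
      then have "norm (app T ((SOME z. z \<in> U) - x)) < e / 2"
        using small x by blast
      then have "y \<in> cball (app T (SOME z. z \<in> U)) (e / 2)"
        using x(1) by (simp add: dist_norm app_diff)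
      then show "y \<in> (\<Union>z\<in>k. cball z (e / 2))"
        using x(3) unfolding k_def by blast
    qed
    moreover have fin: "finite k" using \<C>(1) by (simp add: k_def)
    \<comment> \<open>Closed balls of half the radius are used because their finite union is closed
      and so absorbs the closure.\<close>
    ultimately have "closure ?S \<subseteq> (\<Union>z\<in>k. cball z (e / 2))"
      by (intro closure_minimal closed_UN) simp_all
    also have "\<dots> \<subseteq> (\<Union>z\<in>k. ball z e)" using e by auto
    finally show "\<exists>k. finite k \<and> closure ?S \<subseteq> (\<Union>z\<in>k. ball z e)" using fin by blast
  qed
qed

text \<open>Induction on the set of operators: pairwise intersections of the members of two finite
  covers form a finite cover that is fine for both.\<close>

lemma compact_ops_common_cover:
  assumes "finite \<K>" "\<And>K. K \<in> \<K> \<Longrightarrow> compact_op K" "e > 0"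
  shows "\<exists>\<C>. finite \<C> \<and> cball 0 1 \<subseteq> \<Union>\<C> \<and>
    (\<forall>U\<in>\<C>. \<forall>x\<in>U. \<forall>y\<in>U. \<forall>K\<in>\<K>. norm (app K (x - y)) < e)"
  using assms(1,2)
proof (induction \<K>)
  case empty
  show ?case by (intro exI[of _ "{UNIV}"]) auto
next
  case (insert K \<K>)
  then obtain \<C> where \<C>: "finite \<C>" "cball 0 1 \<subseteq> \<Union>\<C>"
    "\<And>U x y K. U \<in> \<C> \<Longrightarrow> x \<in> U \<Longrightarrow> y \<in> U \<Longrightarrow> K \<in> \<K> \<Longrightarrow> norm (app K (x - y)) < e"
    by (metis insertCI)
  have "compact_op K" using insert.prems by blast
  then obtain \<D> where \<D>: "finite \<D>" "cball 0 1 \<subseteq> \<Union>\<D>"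
    "\<And>U x y. U \<in> \<D> \<Longrightarrow> x \<in> U \<Longrightarrow> y \<in> U \<Longrightarrow> norm (app K (x - y)) < e"
    using \<open>e > 0\<close> unfolding compact_op_iff_cover by metis
  let ?E = "(\<lambda>(U, V). U \<inter> V) ` (\<C> \<times> \<D>)"
  have "finite ?E" using \<C>(1) \<D>(1) by blast
  moreover have "cball 0 1 \<subseteq> \<Union>?E" using \<C>(2) \<D>(2) by fastforce
  ultimately show ?case using \<C>(3) \<D>(3) by (intro exI[of _ ?E]) auto
qed

text \<open>Covers both norm limits of compact operators and operators dominated by finitely many compact
  ones.\<close>

lemma compact_op_dominatedI:
  assumes "\<And>e. e > 0 \<Longrightarrow> \<exists>\<K> \<eta>. finite \<K> \<and> \<eta> > 0 \<and> (\<forall>K\<in>\<K>. compact_op K) \<and>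
     (\<forall>x. norm x \<le> 2 \<longrightarrow> (\<forall>K\<in>\<K>. norm (app K x) < \<eta>) \<longrightarrow> norm (app T x) < e)"
  shows "compact_op T"
  unfolding compact_op_iff_cover
proof (intro allI impI)
  fix e :: real assume "e > 0"
  then obtain \<K> \<eta> where \<K>: "finite \<K>" "\<eta> > 0" "\<And>K. K \<in> \<K> \<Longrightarrow> compact_op K"
    and dom: "\<And>x. norm x \<le> 2 \<Longrightarrow> \<forall>K\<in>\<K>. norm (app K x) < \<eta> \<Longrightarrow> norm (app T x) < e"
    using assms by metis
  obtain \<C> where \<C>: "finite \<C>" "cball 0 1 \<subseteq> \<Union>\<C>"
    "\<And>U x y. U \<in> \<C> \<Longrightarrow> x \<in> U \<Longrightarrow> y \<in> U \<Longrightarrow> \<forall>K\<in>\<K>. norm (app K (x - y)) < \<eta>"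
    using compact_ops_common_cover[OF \<K>(1) \<K>(3) \<K>(2)] by metis
  \<comment> \<open>The pieces are cut down to the unit ball so that differences of their points
    have norm at most 2, as the domination hypothesis demands.\<close>
  let ?C = "(\<lambda>U. U \<inter> cball 0 1) ` \<C>"
  have "norm (app T (x - y)) < e" if "U \<in> \<C>" "x \<in> U" "y \<in> U" "norm x \<le> 1" "norm y \<le> 1" for U x y
    using norm_triangle_ineq4[of x y] that by (intro dom \<C>(3)[of U]) auto
  moreover have "cball 0 1 \<subseteq> \<Union>?C" using \<C>(2) by auto
  ultimately show "\<exists>\<C>. finite \<C> \<and> cball 0 1 \<subseteq> \<Union>\<C> \<and>
      (\<forall>U\<in>\<C>. \<forall>x\<in>U. \<forall>y\<in>U. norm (app T (x - y)) < e)"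
    using \<C>(1) by (intro exI[of _ ?C]) auto
qed

section \<open>Finite rank operators and finitely supported rational vectors\<close>

lemma compact_op_sum: "(\<And>i. i \<in> I \<Longrightarrow> compact_op (T i)) \<Longrightarrow> compact_op (sum T I)"
  by (induction I rule: infinite_finite_induct) (auto simp: compact_op_zero compact_op_add)

text \<open>For a unit vector this is the orthogonal projection onto the line it spans. The choice
  is justified in \<open>app_line_op\<close>.\<close>

definition line_op :: "ell2 \<Rightarrow> bop" where
  "line_op u = (SOME T. app T = (\<lambda>x. scaleC (cinner x u) u))"

lemma app_line_op: "app (line_op u) x = scaleC (cinner x u) u"
proof -
  have "\<exists>T. app T = (\<lambda>x. scaleC (cinner x u) u)"
    using bop_exists[of "\<lambda>x. scaleC (cinner x u) u"]
      bounded_linear_compose[OF bounded_linear_scaleC_left bounded_linear_cinner_left, of u u]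
    by (auto simp: cinner_scaleC_left)
  from someI_ex[OF this] show ?thesis unfolding line_op_def by simp
qed

lemma compact_line_op: "compact_op (line_op u)"
proof (rule compact_opI)
  show "compact ((\<lambda>c. scaleC c u) ` cball 0 (norm u))"
    by (intro compact_continuous_image compact_cball linear_continuous_on bounded_linear_scaleC_left)
  show "app (line_op u) ` cball 0 1 \<subseteq> (\<lambda>c. scaleC c u) ` cball 0 (norm u)"
  proof clarsimp
    fix x :: ell2 assume "norm x \<le> 1"
    then have "cmod (cinner x u) \<le> norm u"
      using cmod_cinner_le[of x u] mult_right_mono[of "norm x" 1 "norm u"] by simp
    then show "app (line_op u) x \<in> (\<lambda>c. scaleC c u) ` cball 0 (norm u)"
      by (simp add: app_line_op)
  qed
qed

definition initial_proj :: "nat \<Rightarrow> bop" where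
  "initial_proj m = (\<Sum>i<m. line_op (basis_vec i))"

lemma compact_initial_proj: "compact_op (initial_proj m)"
  unfolding initial_proj_def by (intro compact_op_sum compact_line_op)

lemma app_initial_proj: "app (initial_proj m) x = (\<Sum>i<m. scaleC (coord x i) (basis_vec i))"
  by (simp add: initial_proj_def app_sum_left app_line_op cinner_basis_vec)

lemma coord_initial_proj: "coord (app (initial_proj m) x) n = (if n < m then coord x n else 0)"
  by (simp add: app_initial_proj coord_sum if_distrib cong: if_cong)

lemma initial_proj_approx:
  assumes "e > 0"
  obtains N where "norm (x - app (initial_proj N) x) < e"
proof -
  obtain N where N: "norm (\<Sum>i. (cmod (coord x (i + N)))\<^sup>2) < e\<^sup>2"
    using suminf_exist_split[OF _ summable_coord, of "e\<^sup>2" x] assms by auto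
  let ?y = "x - app (initial_proj N) x"
  have "(norm ?y)\<^sup>2 = (\<Sum>i. (cmod (coord ?y (i + N)))\<^sup>2) + (\<Sum>i<N. (cmod (coord ?y i))\<^sup>2)"
    unfolding norm_sq_ell2 by (rule suminf_split_initial_segment[OF summable_coord])
  also have "\<dots> = (\<Sum>i. (cmod (coord x (i + N)))\<^sup>2)"
    by (simp add: coord_initial_proj)
  also have "\<dots> < e\<^sup>2" using N by simp
  finally have "norm ?y < e"
    using assms by (metis less_le power_less_imp_less_base)
  then show thesis by (rule that)
qed

text \<open>Vectors are handled through their codes because the codes form a countable type, which
  the chain condition requires. The length of a code also bounds the support of its vector.\<close>

definition rat_vec :: "(rat \<times> rat) list \<Rightarrow> ell2" where
  "rat_vec l = (\<Sum>i<length l.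
     scaleC (Complex (of_rat (fst (l ! i))) (of_rat (snd (l ! i)))) (basis_vec i))"

lemma coord_rat_vec: "coord (rat_vec l) n =
   (if n < length l then Complex (of_rat (fst (l ! n))) (of_rat (snd (l ! n))) else 0)"
  by (simp add: rat_vec_def coord_sum if_distrib cong: if_cong)

lemma rational_complex_approx:
  assumes "e > 0"
  obtains a b where "cmod (Complex (of_rat a) (of_rat b) - z) < e"
proof -
  obtain a where a: "Re z < of_rat a" "of_rat a < Re z + e / 2"
    using of_rat_dense[of "Re z" "Re z + e / 2"] assms by auto
  obtain b where b: "Im z < of_rat b" "of_rat b < Im z + e / 2"
    using of_rat_dense[of "Im z" "Im z + e / 2"] assms by auto
  have "cmod (Complex (of_rat a) (of_rat b) - z) < e"
    using cmod_le[of "Complex (of_rat a) (of_rat b) - z"] a b by simp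
  then show thesis by (rule that)
qed

text \<open>The second conclusion lets the approximation stay among the vectors that vanish on an
  initial segment.\<close>

lemma rat_vec_dense:
  assumes "e > 0"
  obtains l where "norm (rat_vec l - x) < e" "\<And>n. coord x n = 0 \<Longrightarrow> coord (rat_vec l) n = 0"
proof -
  obtain N where N: "norm (x - app (initial_proj N) x) < e / 2"
    using initial_proj_approx[of "e / 2"] assms by auto
  \<comment> \<open>The \<open>N\<close> coordinate errors then add up to at most
    \<open>e / 2\<close>; the added 1 covers \<open>N = 0\<close>.\<close>
  define d where "d = e / (2 * (real N + 1))"
  have "d > 0" using assms by (simp add: d_def)
  have "\<exists>r. cmod (Complex (of_rat (fst r)) (of_rat (snd r)) - coord x n) < d \<and>
      (coord x n = 0 \<longrightarrow> r = (0, 0))" for n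
  proof (cases "coord x n = 0")
    case True
    then show ?thesis using \<open>d > 0\<close> by (intro exI[of _ "(0, 0)"]) (simp flip: zero_complex.code)
  next
    case False
    then show ?thesis using rational_complex_approx[OF \<open>d > 0\<close>, of "coord x n"] by (metis fst_conv snd_conv)
  qed
  then obtain r where r: "\<And>n. cmod (Complex (of_rat (fst (r n))) (of_rat (snd (r n))) - coord x n) < d"
    "\<And>n. coord x n = 0 \<Longrightarrow> r n = (0, 0)" by metis
  let ?l = "map r [0..<N]"
  have "rat_vec ?l - app (initial_proj N) x = (\<Sum>i<N.
      scaleC (Complex (of_rat (fst (r i))) (of_rat (snd (r i))) - coord x i) (basis_vec i))"
    unfolding rat_vec_def app_initial_proj by (simp add: scaleC_diff_left sum_subtractf)
  also have "norm \<dots> \<le> (\<Sum>i<N. d)"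
    by (intro sum_norm_le) (simp add: r(1) less_imp_le)
  also have "\<dots> \<le> e / 2"
    using assms by (simp add: d_def field_simps)
  finally have "norm (rat_vec ?l - x) < e"
    using N norm_triangle_ineq4[of "rat_vec ?l - app (initial_proj N) x" "x - app (initial_proj N) x"]
    by simp
  moreover have "coord (rat_vec ?l) n = 0" if "coord x n = 0" for n
    using r(2)[OF that] by (simp add: coord_rat_vec flip: zero_complex.code)
  ultimately show thesis by (rule that)
qed

text \<open>By contradiction: otherwise the operators in \<open>F\<close> are jointly bounded below
  on all vectors vanishing below \<open>m\<close>, first on rational ones and by density on all.
  Applied to the range of \<open>T\<close> with its first \<open>m\<close> coordinates removed, this
  dominates the truncated operator by compact ones, and \<open>T\<close> differs from it by a
  compact operator.\<close>

lemma noncompact_imp_almost_null_vector: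
  assumes F: "finite F" and T: "\<not> compact_op T" and FT: "\<And>q. q \<in> F \<Longrightarrow> compact_op (q * T)"
    and e: "e > 0"
  shows "\<exists>l. rat_vec l \<noteq> 0 \<and> (\<forall>n<m. coord (rat_vec l) n = 0) \<and>
    (\<forall>q\<in>F. norm (app q (rat_vec l)) \<le> e * norm (rat_vec l))"
proof (rule ccontr)
  assume neg: "\<not> ?thesis"
  \<comment> \<open>A single continuous function in place of an unspecified \<open>q\<close>, so
    that the lower bound passes to limits.\<close>
  let ?f = "\<lambda>v. \<Sum>q\<in>F. norm (app q v)"
  have rat: "e * norm (rat_vec l) \<le> ?f (rat_vec l)" if l: "\<forall>n<m. coord (rat_vec l) n = 0" for l
  proof (cases "rat_vec l = 0")
    case False
    then obtain q where "q \<in> F" "e * norm (rat_vec l) < norm (app q (rat_vec l))"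
      using neg l by (meson not_le)
    then show ?thesis
      using member_le_sum[of q F "\<lambda>q. norm (app q (rat_vec l))"] F by simp
  qed (simp add: sum_nonneg)
  have below: "e * norm v \<le> ?f v" if v: "\<forall>n<m. coord v n = 0" for v
  proof -
    have "\<exists>l. norm (rat_vec l - v) < inverse (real (Suc k)) \<and> (\<forall>n<m. coord (rat_vec l) n = 0)" for k
      using rat_vec_dense[of "inverse (real (Suc k))" v] v by (metis inverse_positive_iff_positive of_nat_0_less_iff zero_less_Suc)
    then obtain l where l: "\<And>k. norm (rat_vec (l k) - v) < inverse (real (Suc k))"
      "\<And>k. \<forall>n<m. coord (rat_vec (l k)) n = 0" by metis
    have lim: "(\<lambda>k. rat_vec (l k)) \<longlonglongrightarrow> v"
      by (rule LIM_zero_cancel, rule Lim_null_comparison[OF _ LIMSEQ_inverse_real_of_nat])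
        (use l(1) in \<open>auto intro!: always_eventually less_imp_le\<close>)
    show ?thesis
    proof (rule LIMSEQ_le)
      show "(\<lambda>k. e * norm (rat_vec (l k))) \<longlonglongrightarrow> e * norm v"
        by (intro tendsto_intros lim)
      show "(\<lambda>k. ?f (rat_vec (l k))) \<longlonglongrightarrow> ?f v"
        by (intro tendsto_intros bounded_linear.tendsto[OF bounded_linear_app] lim)
    qed (use rat l(2) in blast)
  qed
  define S where "S = (1 - initial_proj m) * T"
  have "compact_op S"
  proof (rule compact_op_dominatedI)
    fix d :: real assume d: "d > 0"
    \<comment> \<open>Chosen so that \<open>card F\<close> summands of size \<open>\<eta>\<close>
      stay strictly below \<open>e * d\<close>, also for empty \<open>F\<close>.\<close>
    define \<eta> where "\<eta> = e * d / (real (card F) + 1)"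
    have \<eta>: "\<eta> > 0" using d e by (simp add: \<eta>_def)
    have "compact_op (q * S)" if "q \<in> F" for q
    proof -
      have "q * S = q * T + - (q * (initial_proj m * T))"
        by (simp add: S_def algebra_simps)
      then show ?thesis
        by (simp only: compact_op_add compact_op_uminus FT[OF that] compact_op_mult_left
            compact_op_mult_right compact_initial_proj)
    qed
    moreover have "norm (app S x) < d" if small: "\<forall>q\<in>F. norm (app (q * S) x) < \<eta>" for x
    proof -
      have "e * norm (app S x) \<le> ?f (app S x)"
        by (rule below) (simp add: S_def coord_initial_proj)
      also have "\<dots> \<le> (\<Sum>q\<in>F. \<eta>)"
        using small by (intro sum_mono) (simp add: less_imp_le)
      also have "\<dots> < e * d"
        using d e by (simp add: \<eta>_def field_simps)
      finally show ?thesis using e by simp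
    qed
    ultimately show "\<exists>\<K> \<eta>. finite \<K> \<and> \<eta> > 0 \<and> (\<forall>K\<in>\<K>. compact_op K) \<and>
        (\<forall>x. norm x \<le> 2 \<longrightarrow> (\<forall>K\<in>\<K>. norm (app K x) < \<eta>) \<longrightarrow> norm (app S x) < d)"
      using F \<eta> by (intro exI[of _ "(\<lambda>q. q * S) ` F"] exI[of _ \<eta>]) auto
  qed
  then have "compact_op (S + initial_proj m * T)"
    by (intro compact_op_add compact_op_mult_right compact_initial_proj)
  moreover have "S + initial_proj m * T = T" by (simp add: S_def algebra_simps)
  ultimately show False using T by simp
qed

section \<open>Projections onto closed spans of orthonormal sequences\<close>

locale orthonormal_sequence =
  fixes u :: "nat \<Rightarrow> ell2"
  assumes orthonormal: "cinner (u i) (u j) = (if i = j then 1 else 0)"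
begin

lemma norm_u [simp]: "norm (u i) = 1"
proof -
  have "of_real ((norm (u i))\<^sup>2) = (1 :: complex)"
    using orthonormal[of i i] by (simp only: cinner_self) simp
  then have "(norm (u i))\<^sup>2 = 1" by (simp only: of_real_eq_1_iff)
  then show ?thesis using norm_ge_zero[of "u i"] by (simp add: power2_eq_1_iff)
qed

lemma norm_sum_sq: "finite I \<Longrightarrow> (norm (\<Sum>i\<in>I. scaleC (c i) (u i)))\<^sup>2 = (\<Sum>i\<in>I. (cmod (c i))\<^sup>2)"
  by (subst norm_sum_Pythagorean)
    (auto simp: pairwise_def orthogonal_def inner_ell2_def cinner_scaleC_left cinner_scaleC_right
      orthonormal)

text \<open>The partial expansion \<open>?s\<close> has squared norm equal to its inner product with
  \<open>x\<close>, so Cauchy-Schwarz gives that its norm is at most that of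
  \<open>x\<close>.\<close>

lemma bessel: "finite I \<Longrightarrow> (\<Sum>i\<in>I. (cmod (cinner x (u i)))\<^sup>2) \<le> (norm x)\<^sup>2"
proof -
  assume I: "finite I"
  let ?s = "\<Sum>i\<in>I. scaleC (cinner x (u i)) (u i)"
  have "cinner (u i) x = cnj (cinner x (u i))" for i
    by (simp only: cnj_cinner)
  then have "cinner ?s x = (\<Sum>i\<in>I. of_real ((cmod (cinner x (u i)))\<^sup>2))"
    by (simp only: cinner_sum_left cinner_scaleC_left complex_norm_square)
  then have "(norm ?s)\<^sup>2 = inner ?s x"
    unfolding norm_sum_sq[OF I] inner_ell2_def by simp
  also have "\<dots> \<le> norm ?s * norm x" by (rule norm_cauchy_schwarz)
  finally have "norm ?s \<le> norm x"
    by (cases "norm ?s = 0") (auto simp: power2_eq_square)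
  then have "(norm ?s)\<^sup>2 \<le> (norm x)\<^sup>2" by (intro power_mono) auto
  then show ?thesis unfolding norm_sum_sq[OF I] .
qed

text \<open>By Pythagoras the squared norm of a block of the series is the corresponding block of
  the convergent Bessel series.\<close>

lemma summable_expansion: "summable (\<lambda>i. scaleC (cinner x (u i)) (u i))"
proof -
  have "summable (\<lambda>i. (cmod (cinner x (u i)))\<^sup>2)"
    using bessel by (intro bounded_imp_summable[of _ "(norm x)\<^sup>2"]) auto
  show ?thesis
    unfolding summable_Cauchy
  proof (intro allI impI)
    fix e :: real assume e: "e > 0"
    then obtain N where N: "\<And>m n. m \<ge> N \<Longrightarrow> norm (\<Sum>i=m..<n. (cmod (cinner x (u i)))\<^sup>2) < e\<^sup>2"
      using \<open>summable _\<close> unfolding summable_Cauchy by (metis zero_less_power)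
    have "norm (\<Sum>i=m..<n. scaleC (cinner x (u i)) (u i)) < e" if "m \<ge> N" for m n
    proof -
      have "(norm (\<Sum>i=m..<n. scaleC (cinner x (u i)) (u i)))\<^sup>2 < e\<^sup>2"
        using N[OF that, of n] by (simp add: norm_sum_sq)
      then show ?thesis using e by (meson less_le power_less_imp_less_base)
    qed
    then show "\<exists>N. \<forall>m\<ge>N. \<forall>n. norm (\<Sum>i=m..<n. scaleC (cinner x (u i)) (u i)) < e" by blast
  qed
qed

text \<open>Bessel makes the expansion a contraction. It is idempotent because
  \<open>app p x\<close> has the same coefficients as \<open>x\<close>, and self-adjoint because
  both inner products are sums of the same series.\<close>

lemma closed_span_projection:
  obtains p where "projection p" "\<forall>x. app p x = (\<Sum>i. scaleC (cinner x (u i)) (u i))"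
proof -
  let ?f = "\<lambda>x. \<Sum>i. scaleC (cinner x (u i)) (u i)"
  have sums: "(\<lambda>i. scaleC (cinner x (u i)) (u i)) sums ?f x" for x
    by (rule summable_sums[OF summable_expansion])
  have norm_le: "norm (?f x) \<le> norm x" for x
  proof (rule LIMSEQ_le_const2)
    show "(\<lambda>n. norm (\<Sum>i<n. scaleC (cinner x (u i)) (u i))) \<longlonglongrightarrow> norm (?f x)"
      by (intro tendsto_norm sums[unfolded sums_def])
    have "norm (\<Sum>i<n. scaleC (cinner x (u i)) (u i)) \<le> norm x" for n
    proof (rule power2_le_imp_le)
      show "(norm (\<Sum>i<n. scaleC (cinner x (u i)) (u i)))\<^sup>2 \<le> (norm x)\<^sup>2"
        using bessel[of "{..<n}" x] by (simp add: norm_sum_sq)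
    qed simp
    then show "\<exists>N. \<forall>n\<ge>N. norm (\<Sum>i<n. scaleC (cinner x (u i)) (u i)) \<le> norm x" by blast
  qed
  have scaleC: "?f (scaleC c x) = scaleC c (?f x)" for c x
    unfolding bounded_linear.suminf[OF bounded_linear_scaleC_right summable_expansion]
    by (simp add: cinner_scaleC_left)
  have "bounded_linear ?f"
  proof (rule bounded_linear_intro[of _ 1])
    show "?f (x + y) = ?f x + ?f y" for x y
      unfolding suminf_add[OF summable_expansion summable_expansion]
      by (simp add: cinner_add_left scaleC_add_left)
    show "?f (r *\<^sub>R x) = r *\<^sub>R ?f x" for r x
      using scaleC[of "of_real r" x] by (simp only: scaleC_of_real)
  qed (simp add: norm_le)
  then obtain p where p: "app p = ?f"
    using scaleC by (rule bop_exists)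
  have cinner_p: "(\<lambda>i. cinner x (u i) * cinner (u i) y) sums cinner (app p x) y" for x y
    unfolding p using bounded_linear.sums[OF bounded_linear_cinner_left sums]
    by (simp add: cinner_scaleC_left)
  have coeff: "cinner (app p x) (u j) = cinner x (u j)" for x j
  proof (rule sums_unique2[OF cinner_p])
    show "(\<lambda>i. cinner x (u i) * cinner (u i) (u j)) sums cinner x (u j)"
      using sums_single[of j "\<lambda>i. cinner x (u i)"] by (simp add: orthonormal if_distrib cong: if_cong)
  qed
  have "p * p = p"
    by (rule bop_eqI) (simp add: p coeff[unfolded p])
  moreover have "adjoint_pair p p"
    unfolding adjoint_pair_def
  proof (intro allI)
    fix x y
    have "(\<lambda>i. cnj (cinner y (u i) * cinner (u i) x)) sums cnj (cinner (app p y) x)"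
      using cinner_p by (simp only: sums_cnj)
    then have "(\<lambda>i. cinner x (u i) * cinner (u i) y) sums cinner x (app p y)"
      by (simp add: cnj_cinner mult.commute)
    then show "cinner (app p x) y = cinner x (app p y)"
      by (rule sums_unique2[OF cinner_p])
  qed
  ultimately show thesis
    using that p unfolding projection_def by metis
qed

text \<open>The vectors \<open>u i\<close> lie in the unit ball at mutual distance the square root
  of 2. A finite cover puts two of them into one piece, where their images, the vectors themselves,
  would be closer than 1.\<close>

lemma noncompact_if_fixes:
  assumes p: "\<And>i. app p (u i) = u i"
  shows "\<not> compact_op p"
proof
  assume "compact_op p"
  then obtain \<C> where \<C>: "finite \<C>" "cball 0 1 \<subseteq> \<Union>\<C>"
    and small: "\<And>U x y. U \<in> \<C> \<Longrightarrow> x \<in> U \<Longrightarrow> y \<in> U \<Longrightarrow> norm (app p (x - y)) < 1"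
    unfolding compact_op_iff_cover by (metis zero_less_one)
  have "\<exists>U\<in>\<C>. u i \<in> U" for i
    using \<C>(2) by (auto simp: subset_iff)
  then obtain U where U: "\<And>i. U i \<in> \<C>" "\<And>i. u i \<in> U i" by metis
  have "\<not> inj U"
    using U(1) \<C>(1) by (meson finite_imageD finite_subset image_subsetI infinite_UNIV_nat)
  then obtain i j where ij: "i \<noteq> j" "U i = U j" by (auto simp: inj_def)
  have "inner (u i) (u j) = 0"
    using ij(1) by (simp add: inner_ell2_def orthonormal)
  then have "orthogonal (u i) (- u j)"
    by (simp add: orthogonal_def)
  then have "(norm (u i - u j))\<^sup>2 = 2"
    using norm_add_Pythagorean[of "u i" "- u j"] by simp
  moreover have "norm (u i - u j) < 1"
    using small[of "U i" "u i" "u j"] U[of i] U(2)[of j] ij by (simp add: app_diff p)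
  then have "(norm (u i - u j))\<^sup>2 \<le> 1\<^sup>2" by (intro power_mono) auto
  ultimately show False by simp
qed

text \<open>One \<open>p\<close> serves all \<open>q\<close>. Self-adjointness turns the
  coefficients of \<open>app q x\<close> into inner products of \<open>x\<close> with
  \<open>app q (u i)\<close>, which decay geometrically; hence \<open>p * q\<close> is a norm limit
  of its finite rank truncations \<open>?K\<close>.\<close>

lemma projection_almost_orthogonal:
  obtains p where "projection p" "\<not> compact_op p"
    "\<And>q. projection q \<Longrightarrow> \<exists>N. \<forall>n\<ge>N. norm (app q (u n)) \<le> (1 / 2) ^ n \<Longrightarrow> compact_op (p * q)"
proof -
  obtain p where p: "projection p" "\<forall>x. app p x = (\<Sum>i. scaleC (cinner x (u i)) (u i))"
    by (rule closed_span_projection)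
  have "app p (u j) = u j" for j
    unfolding p(2)[rule_format] by (subst suminf_finite[of "{j}"]) (auto simp: orthonormal)
  then have "\<not> compact_op p" by (rule noncompact_if_fixes)
  moreover have "compact_op (p * q)"
    if q: "projection q" and decay: "\<exists>N. \<forall>n\<ge>N. norm (app q (u n)) \<le> (1 / 2) ^ n" for q
  proof (rule compact_op_dominatedI)
    fix e :: real assume e: "e > 0"
    obtain N where N: "\<And>n. n \<ge> N \<Longrightarrow> norm (app q (u n)) \<le> (1 / 2) ^ n" using decay by blast
    \<comment> \<open>On vectors of norm at most 2 the tail from \<open>k\<close> on is at most
      \<open>4 * (1 / 2) ^ k\<close>. With \<open>k\<close> at least \<open>M\<close> this is below
      \<open>e / 2\<close>, and the truncation gets the other half.\<close>
    obtain M where M: "(1 / 2 :: real) ^ M < e / 8"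
      using real_arch_pow_inv[of "e / 8" "1 / 2"] e by auto
    define k where "k = max N M"
    let ?K = "(\<Sum>i<k. line_op (u i)) * q"
    have "norm (app (p * q) x) < e" if x: "norm x \<le> 2" and small: "norm (app ?K x) < e / 2" for x
    proof -
      let ?g = "\<lambda>i. scaleC (cinner (app q x) (u i)) (u i)"
      have bound: "norm (?g (i + k)) \<le> 2 * (1 / 2) ^ k * (1 / 2) ^ i" for i
      proof -
        have "cinner (app q x) (u (i + k)) = cinner x (app q (u (i + k)))"
          using q by (simp add: projection_def adjoint_pair_def)
        then have "norm (?g (i + k)) \<le> norm x * norm (app q (u (i + k)))"
          using cmod_cinner_le by simp
        also have "\<dots> \<le> 2 * (1 / 2) ^ (i + k)"
          using x N[of "i + k"] by (intro mult_mono) (auto simp: k_def)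
        finally show ?thesis by (simp add: power_add mult_ac)
      qed
      have geo: "(\<lambda>i. 2 * (1 / 2) ^ k * (1 / 2) ^ i) sums (4 * (1 / 2 :: real) ^ k)"
        using sums_mult[OF geometric_sums[of "1 / 2 :: real"], of "2 * (1 / 2) ^ k"] by simp
      have "app (p * q) x = (\<Sum>i. ?g (i + k)) + app ?K x"
        by (simp add: p(2) suminf_split_initial_segment[OF summable_expansion, of _ k] app_sum_left app_line_op)
      also have "norm \<dots> \<le> norm (\<Sum>i. ?g (i + k)) + norm (app ?K x)"
        by (rule norm_triangle_ineq)
      also have "norm (\<Sum>i. ?g (i + k)) \<le> (\<Sum>i. 2 * (1 / 2) ^ k * (1 / 2) ^ i)"
        using geo bound by (intro norm_suminf_le) (auto simp: sums_iff)
      also have "\<dots> = 4 * (1 / 2) ^ k" using geo by (simp add: sums_iff)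
      also have "\<dots> \<le> 4 * (1 / 2) ^ M"
        by (intro mult_left_mono power_decreasing) (auto simp: k_def)
      finally show ?thesis using M small by simp
    qed
    moreover have "compact_op ?K"
      by (intro compact_op_mult_right compact_op_sum compact_line_op)
    ultimately show "\<exists>\<K> \<eta>. finite \<K> \<and> \<eta> > 0 \<and> (\<forall>K\<in>\<K>. compact_op K) \<and>
        (\<forall>x. norm x \<le> 2 \<longrightarrow> (\<forall>K\<in>\<K>. norm (app K x) < \<eta>) \<longrightarrow> norm (app (p * q) x) < e)"
      using e by (intro exI[of _ "{?K}"] exI[of _ "e / 2"]) auto
  qed
  ultimately show thesis using p(1) by (intro that)
qed

end

section \<open>From the join hypothesis to the almost orthogonal projection\<close>

lemma not_join_one_witness:
  assumes "\<not> is_join (\<pi> ` F) 1"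
  obtains T where "\<not> compact_op T" "\<And>q. q \<in> F \<Longrightarrow> compact_op (q * T)"
proof -
  have "adjoint_pair 1 1" by (simp add: adjoint_pair_def)
  then have "(1 :: calkin) \<in> calkin_projections"
    unfolding calkin_projections_def using one_calkin.abs_eq by auto
  moreover have "calkin_le (\<pi> q) 1" for q
    by (simp add: one_calkin.abs_eq calkin_le.abs_eq compact_op_zero)
  \<comment> \<open>Since 1 is a projection and an upper bound, it can only fail to be the join by
    not being least. For a representative \<open>Y\<close> of \<open>y\<close>, the two facts say
    that \<open>q * (1 - Y)\<close> is compact and \<open>1 - Y\<close> is not.\<close>
  ultimately obtain y where y: "\<And>q. q \<in> F \<Longrightarrow> calkin_le (\<pi> q) y" "\<not> calkin_le 1 y"
    using assms unfolding is_join_def by blast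
  obtain Y where "y = \<pi> Y" using Quotient3_abs_rep[OF Quotient3_calkin] by metis
  then show thesis
    using y that[of "1 - Y"] by (simp add: one_calkin.abs_eq calkin_le.abs_eq)
qed

lemma cinner_disjoint_support:
  assumes "\<And>n. coord x n = 0 \<or> coord y n = 0"
  shows "cinner x y = 0"
proof -
  have "coord x n * cnj (coord y n) = 0" for n
    using assms[of n] by auto
  then show ?thesis by (simp only: cinner_def suminf_zero)
qed

theorem mainTheorem11:
  fixes A :: "bop set"
  assumes "martins_axiom"
    and "\<forall>q\<in>A. projection q"
    and "|A| <o |UNIV :: nat set set|"
    and "\<not> (\<exists>F. finite F \<and> F \<subseteq> A \<and> is_join (\<pi> ` F) 1)"
  shows "\<exists>p. projection p \<and> \<not> compact_op p \<and> (\<forall>q\<in>A. compact_op (p * q))"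
proof -
  \<comment> \<open>The new vector starts beyond the length of every earlier code, hence beyond
    every earlier support.\<close>
  define S :: "(rat \<times> rat) list list \<Rightarrow> (rat \<times> rat) list \<Rightarrow> bool" where
    "S s c \<longleftrightarrow> rat_vec c \<noteq> 0 \<and> (\<forall>d\<in>set s. \<forall>n<length d. coord (rat_vec c) n = 0)" for s c
  \<comment> \<open>\<open>length s\<close> is the index that the new entry receives, so the n-th
    vector is tested with tolerance \<open>(1 / 2) ^ n\<close>.\<close>
  define R :: "bop \<Rightarrow> (rat \<times> rat) list list \<Rightarrow> (rat \<times> rat) list \<Rightarrow> bool" where
    "R q s c \<longleftrightarrow> norm (app q (rat_vec c)) \<le> (1 / 2) ^ length s * norm (rat_vec c)" for q s c
  have step: "\<exists>c. S s c \<and> (\<forall>q\<in>F. R q s c)" if F: "finite F" "F \<subseteq> A" for s F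
  proof -
    have "\<not> is_join (\<pi> ` F) 1" using F assms(4) by blast
    then obtain T where T: "\<not> compact_op T" "\<And>q. q \<in> F \<Longrightarrow> compact_op (q * T)"
      by (rule not_join_one_witness) blast
    \<comment> \<open>A convenient common upper bound for the lengths of the earlier codes.\<close>
    define m where "m = sum_list (map length s)"
    obtain c where c: "rat_vec c \<noteq> 0" "\<forall>n<m. coord (rat_vec c) n = 0"
      "\<forall>q\<in>F. norm (app q (rat_vec c)) \<le> (1 / 2) ^ length s * norm (rat_vec c)"
      using noncompact_imp_almost_null_vector[OF F(1) T, of "(1 / 2) ^ length s" m] by auto
    have "length d \<le> m" if "d \<in> set s" for d
      unfolding m_def using that by (auto intro!: member_le_sum_list)
    then have "S s c" unfolding S_def using c by (meson less_le_trans)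
    then show ?thesis using c(3) unfolding R_def by blast
  qed
  obtain g where gS: "\<And>n. S (map g [0..<n]) (g n)"
    and gR: "\<And>q. q \<in> A \<Longrightarrow> \<exists>N. \<forall>n\<ge>N. R q (map g [0..<n]) (g n)"
    using martins_axiom_sequence[where S = S and R = R, OF assms(1,3) step] by metis
  define v where "v n = rat_vec (g n)" for n
  \<comment> \<open>Normalising turns the relative estimate of \<open>R\<close> into the absolute
    decay required for \<open>p\<close>.\<close>
  define u where "u n = scaleC (of_real (inverse (norm (v n)))) (v n)" for n
  have v: "v n \<noteq> 0" for n
    using gS[of n] by (simp add: S_def v_def)
  \<comment> \<open>The vector \<open>v i\<close> vanishes from \<open>length (g i)\<close> on, and
    \<open>v j\<close> vanishes before it.\<close>
  have disj: "coord (v i) n = 0 \<or> coord (v j) n = 0" if "i < j" for i j n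
    using gS[of j] that by (auto simp: S_def v_def coord_rat_vec[of "g i"])
  have "cinner (v i) (v j) = 0" if "i \<noteq> j" for i j
    using that disj by (intro cinner_disjoint_support) (metis nat_neq_iff)
  then have "cinner (u i) (u j) = (if i = j then 1 else 0)" for i j
    using v[of j] by (simp add: u_def cinner_scaleC_left cinner_scaleC_right cinner_self
        power2_eq_square field_simps)
  then interpret orthonormal_sequence u
    by unfold_locales
  obtain p where p: "projection p" "\<not> compact_op p"
    "\<And>q. projection q \<Longrightarrow> \<exists>N. \<forall>n\<ge>N. norm (app q (u n)) \<le> (1 / 2) ^ n \<Longrightarrow> compact_op (p * q)"
    by (rule projection_almost_orthogonal) blast
  have "compact_op (p * q)" if q: "q \<in> A" for q
  proof (rule p(3))
    show "projection q" using q assms(2) by blast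
    obtain N where N: "\<And>n. n \<ge> N \<Longrightarrow> R q (map g [0..<n]) (g n)"
      using gR[OF q] by blast
    have "norm (app q (u n)) \<le> (1 / 2) ^ n" if "n \<ge> N" for n
    proof -
      have "norm (app q (v n)) \<le> (1 / 2) ^ n * norm (v n)"
        using N[OF that] by (simp add: R_def v_def)
      then show ?thesis
        using v[of n] by (simp add: u_def app_scaleC norm_inverse norm_divide field_simps)
    qed
    then show "\<exists>N. \<forall>n\<ge>N. norm (app q (u n)) \<le> (1 / 2) ^ n" by blast
  qed
  then show ?thesis using p(1,2) by blast
qed

end
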